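(* Let $\mu\in\mathbb R$, $\sigma\ge0$, $\eta>0$, $c\ge0$, put $m:=\mu-\eta c$, and let $U$, $(p_j,\omega_j)_{j=1}^J$, $(\pi_j)_{j=0}^J$, $\Psi_{\max}$, $G$ be as in the context. For $\sigma^2>0$, the worst-case liability equals $\Psi_{\max}(c)=G(\mu-\eta c)$, and it is attained by a staircase load: there are levels $c_0^*\le c_1^*\le\cdots\le c_J^*$ that solve the finite program $$\max\Bigl\{\sum_{j=1}^J\omega_jU(c_j):\ c_0\le c_1\le\cdots\le c_J,\ \sum_{j=0}^J\pi_jc_j=m,\ \sum_{j=0}^J\pi_jc_j^2=m^2+\sigma^2\Bigr\},$$ whose maximum equals $G(m)$, and the supremum is attained by the load whose overload (load minus $\eta c$) has quantile function equal to $c_0^*$ on $[0,p_1)$ and $c_j^*$ on $[p_j,p_{j+1})$, $j=1,\dots,J$, with $p_{J+1}:=1$. In the degenerate case $\sigma^2=0$ the ambiguity set collapses to the Dirac mass (at $m$ in overload coordinates) and $G(m)=U(m)$. For $\sigma^2>0$ the worst case has the following structure. (a) There exist $\lambda_1,\lambda_2\in\mathbb R$, selectors $\xi_j\in\partial U(c_j^* )$ (Clarke subdifferential) for $j=1,\dots,J$, and multipliers $\nu_j\ge0$ for $j=0,\dots,J-1$, with $\nu_J:=0$, such that $$0=\pi_0(\lambda_1+2\lambda_2c_0^* )+\nu_0,$$ $$\omega_j\xi_j=\pi_j(\lambda_1+2\lambda_2c_j^* )+(\nu_j-\nu_{j-1}),\quad j=1,\dots,J,$$ with $\nu_j(c_{j+1}^*-c_j^*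 )=0$ for $j=0,\dots,J-1$. If $\lambda_2>0$, put $\ell^*:=-\lambda_1/(2\lambda_2)$; then every percentile $p_j$ ($1\le j\le J$) whose level $c_j^*$ is isolated from its neighbors (distinct from the adjacent levels) satisfies $c_j^*=\ell^*+\omega_j\xi_j/(2\lambda_2\pi_j)$, and $c_0^*=\ell^*$ whenever $c_0^*<c_1^*$. Moreover, whenever $\lambda_2>0$, the levels $(c_0^*,\dots,c_J^* )$ are the $\pi$-weighted isotonic regression of the candidate $R_0:=\ell^*$, $R_j:=\ell^*+\omega_j\xi_j/(2\lambda_2\pi_j)$ ($1\le j\le J$), i.e. the minimizer of $\sum_{j=0}^J\pi_j(x_j-R_j)^2$ over $x_0\le x_1\le\cdots\le x_J$, computed by the pool-adjacent-violators algorithm with weights $\pi_j$. (b) The optimal levels satisfy $c_0^*\le c_1^*\le\cdots\le c_J^*$, so the credit tier of $p_j$ is nondecreasing in $j$. If $c_0^*<a_1$, then the bulk mass on $[0,p_1)$ is benign, and the levels $c_j^*$ are nondecreasing across the tiers of $U$. (c) Each catastrophic percentile contributes credit $\bar U$ (that is, $U(c_j^* )=\bar U$), each benign percentile contributes $0$, and $0\le G(m)\le\bar U$. When $\lambda_2>0$, the isotonic projection step is computed in time linear in the number $n$ of levels on which it is carried out.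
   Context: Credit utility: for $K\ge1$, $a_1<b_1\le a_2<b_2\le\cdots\le a_K<b_K$ and $g_k>0$, $$U(y)=\sum_{k=1}^Kg_k\bigl((y-a_k)_+-(y-b_k)_+\bigr),\qquad \bar U:=U(b_K)=\sum_{k=1}^Kg_k(b_k-a_k),$$ where $(x)_+=\max\{x,0\}$. Named percentiles: $0<p_1<\cdots<p_J<1$ with weights $\omega_j>0$, $\sum_j\omega_j=1$. Breakpoint masses: $\pi_0:=p_1$, $\pi_j:=p_{j+1}-p_j$ for $1\le j\le J-1$, $\pi_J:=1-p_J$. $\mathcal P(\mu,\sigma^2)$ is the set of distributions on $\mathbb R$ with mean $\mu$ and variance $\sigma^2$. Quantiles use the upper generalized inverse $F_X^{-1}(p):=\inf\{x:F_X(x)>p\}$. Worst-case liability at capacity $c$: $$\Psi_{\max}(c):=\sup_{X\in\mathcal P(\mu,\sigma^2)}\sum_{j=1}^J\omega_jU\bigl(F_X^{-1}(p_j)-\eta c\bigr).$$ Reduced worst-case credit: $$G(m):=\sup\Bigl\{\sum_{j=1}^J\omega_jU(q(p_j)):\ q\in\mathsf K,\ \int_0^1q\,\mathrm du=m,\ \int_0^1q^2\,\mathrm du=m^2+\sigma^2\Bigr\},$$ where $\mathsf K$ is the cone of square-integrable nondecreasing functions on $(0,1)$ (upper, i.e. right-continuous, quantile convention at the points $p_j$). Tiers: given optimal levels $c_j^*$, percentile $p_j$ is benign if $c_j^*<a_1$, breaching if $c_j^*\in[a_1,b_K)$, catastrophic if $c_j^*\ge b_K$; tiers are ordered benign, breaching,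 catastrophic. The bulk mass on $[0,p_1)$ is called benign if its level $c_0^*$ is $<a_1$. Clarke subdifferential of a locally Lipschitz $U:\mathbb R\to\mathbb R$: $\partial U(x)=\{v: vh\le U^\circ(x;h)\ \forall h\in\mathbb R\}$ with $U^\circ(x;h)=\limsup_{y\to x,\,t\to0^+}\frac{U(y+th)-U(y)}{t}$. *)

theory Defs
  imports "HOL-Probability.Probability"
begin

section \<open>Credit utility and tiers\<close>

definition credit_utility ::
    "nat \<Rightarrow> (nat \<Rightarrow> real) \<Rightarrow> (nat \<Rightarrow> real) \<Rightarrow> (nat \<Rightarrow> real) \<Rightarrow> real \<Rightarrow> real" where
  "credit_utility K a b g y = (\<Sum>k=1..K. g k * (max (y - a k) 0 - max (y - b k) 0))"

datatype tier = Benign | Breaching | Catastrophic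

instantiation tier :: linorder
begin

fun tier_rank :: "tier \<Rightarrow> nat" where
  "tier_rank Benign = 0"
| "tier_rank Breaching = 1"
| "tier_rank Catastrophic = 2"

definition less_eq_tier :: "tier \<Rightarrow> tier \<Rightarrow> bool" where
  "s \<le> t \<longleftrightarrow> tier_rank s \<le> tier_rank t"

definition less_tier :: "tier \<Rightarrow> tier \<Rightarrow> bool" where
  "s < t \<longleftrightarrow> tier_rank s < tier_rank t"

instance
proof
  fix s t :: tier
  assume "s \<le> t" "t \<le> s"
  then show "s = t" by (cases s; cases t) (simp_all add: less_eq_tier_def)
qed (auto simp: less_eq_tier_def less_tier_def)

end

definition credit_tier :: "nat \<Rightarrow> (nat \<Rightarrow> real) \<Rightarrow> (nat \<Rightarrow> real) \<Rightarrow> real \<Rightarrow> tier" where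
  "credit_tier K a b x =
     (if x < a 1 then Benign else if x < b K then Breaching else Catastrophic)"


section \<open>Percentiles, ambiguity set and worst-case credit\<close>

text \<open>Right endpoint of the piece starting at \<open>p j\<close>, with the convention that the one after
  \<open>p J\<close> is \<open>1\<close>.\<close>

definition next_percentile :: "nat \<Rightarrow> (nat \<Rightarrow> real) \<Rightarrow> nat \<Rightarrow> real" where
  "next_percentile J p j = (if j < J then p (j + 1) else 1)"

definition breakpoint_mass :: "nat \<Rightarrow> (nat \<Rightarrow> real) \<Rightarrow> nat \<Rightarrow> real" where
  "breakpoint_mass J p j = (if j = 0 then p 1 else next_percentile J p j - p j)"

text \<open>Loads enter only through their laws, so the ambiguity set consists of Borel probability
  measures on the real line.\<close>

definition ambiguity_set :: "real \<Rightarrow> real \<Rightarrow> real measure set" where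
  "ambiguity_set \<mu> s2 = {M. real_distribution M \<and>
     integrable M (\<lambda>x. x) \<and> integrable M (\<lambda>x. x\<^sup>2) \<and>
     (LINT x|M. x) = \<mu> \<and> (LINT x|M. (x - \<mu>)\<^sup>2) = s2}"

definition upper_quantile :: "real measure \<Rightarrow> real \<Rightarrow> real" where
  "upper_quantile M u = Inf {x. cdf M x > u}"

definition liability ::
    "(real \<Rightarrow> real) \<Rightarrow> nat \<Rightarrow> (nat \<Rightarrow> real) \<Rightarrow> (nat \<Rightarrow> real) \<Rightarrow> real \<Rightarrow> real \<Rightarrow> real measure \<Rightarrow> real" where
  "liability U J p \<omega> \<eta> c M = (\<Sum>j=1..J. \<omega> j * U (upper_quantile M (p j) - \<eta> * c))"

definition worst_liability ::
    "(real \<Rightarrow> real) \<Rightarrow> nat \<Rightarrow> (nat \<Rightarrow> real) \<Rightarrow> (nat \<Rightarrow> real) \<Rightarrow> real \<Rightarrow> real \<Rightarrow> real \<Rightarrow> real \<Rightarrow> real" where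
  "worst_liability U J p \<omega> \<mu> \<sigma> \<eta> c = (SUP M\<in>ambiguity_set \<mu> (\<sigma>\<^sup>2). liability U J p \<omega> \<eta> c M)"

definition quantile_cone :: "nat \<Rightarrow> (nat \<Rightarrow> real) \<Rightarrow> (real \<Rightarrow> real) set" where
  "quantile_cone J p = {q. mono_on {0<..<1} q \<and>
     set_integrable lborel {0<..<1} (\<lambda>u. (q u)\<^sup>2) \<and>
     (\<forall>j\<in>{1..J}. continuous (at_right (p j)) q)}"

definition reduced_credit ::
    "(real \<Rightarrow> real) \<Rightarrow> nat \<Rightarrow> (nat \<Rightarrow> real) \<Rightarrow> (nat \<Rightarrow> real) \<Rightarrow> real \<Rightarrow> real \<Rightarrow> real" where
  "reduced_credit U J p \<omega> \<sigma> m =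
     Sup {(\<Sum>j=1..J. \<omega> j * U (q (p j))) | q. q \<in> quantile_cone J p \<and>
       (LINT u:{0<..<1}|lborel. q u) = m \<and>
       (LINT u:{0<..<1}|lborel. (q u)\<^sup>2) = m\<^sup>2 + \<sigma>\<^sup>2}"


section \<open>The finite program\<close>

text \<open>Level vectors are functions on \<open>nat\<close> of which only the values at \<open>0, \<dots>, J\<close> matter.\<close>

definition program_feasible ::
    "nat \<Rightarrow> (nat \<Rightarrow> real) \<Rightarrow> real \<Rightarrow> real \<Rightarrow> (nat \<Rightarrow> real) \<Rightarrow> bool" where
  "program_feasible J \<pi> \<sigma> m x \<longleftrightarrow> (\<forall>j<J. x j \<le> x (j + 1)) \<and>
     (\<Sum>j=0..J. \<pi> j * x j) = m \<and> (\<Sum>j=0..J. \<pi> j * (x j)\<^sup>2) = m\<^sup>2 + \<sigma>\<^sup>2"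

definition program_value ::
    "(real \<Rightarrow> real) \<Rightarrow> nat \<Rightarrow> (nat \<Rightarrow> real) \<Rightarrow> (nat \<Rightarrow> real) \<Rightarrow> real" where
  "program_value U J \<omega> x = (\<Sum>j=1..J. \<omega> j * U (x j))"

definition solves_program ::
    "(real \<Rightarrow> real) \<Rightarrow> nat \<Rightarrow> (nat \<Rightarrow> real) \<Rightarrow> (nat \<Rightarrow> real) \<Rightarrow> real \<Rightarrow> real \<Rightarrow> (nat \<Rightarrow> real) \<Rightarrow> bool" where
  "solves_program U J \<omega> \<pi> \<sigma> m x \<longleftrightarrow> program_feasible J \<pi> \<sigma> m x \<and>
     (\<forall>y. program_feasible J \<pi> \<sigma> m y \<longrightarrow> program_value U J \<omega> y \<le> program_value U J \<omega> x)"

text \<open>The base point \<open>y\<close> of the difference quotients ranges over full neighbourhoods of \<open>x\<close>,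
  the point \<open>x\<close> included.\<close>

definition clarke_derivative :: "(real \<Rightarrow> real) \<Rightarrow> real \<Rightarrow> real \<Rightarrow> ereal" where
  "clarke_derivative f x h =
     Limsup (nhds x \<times>\<^sub>F at_right 0) (\<lambda>(y, t). ereal ((f (y + t * h) - f y) / t))"

definition clarke_subdifferential :: "(real \<Rightarrow> real) \<Rightarrow> real \<Rightarrow> real set" where
  "clarke_subdifferential f x = {v. \<forall>h. ereal (v * h) \<le> clarke_derivative f x h}"

definition program_multipliers ::
    "(real \<Rightarrow> real) \<Rightarrow> nat \<Rightarrow> (nat \<Rightarrow> real) \<Rightarrow> (nat \<Rightarrow> real) \<Rightarrow> (nat \<Rightarrow> real) \<Rightarrow>
     real \<Rightarrow> real \<Rightarrow> (nat \<Rightarrow> real) \<Rightarrow> (nat \<Rightarrow> real) \<Rightarrow> bool" where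
  "program_multipliers U J \<omega> \<pi> x lam1 lam2 \<xi> \<nu> \<longleftrightarrow>
     (\<forall>j\<in>{1..J}. \<xi> j \<in> clarke_subdifferential U (x j)) \<and>
     (\<forall>j<J. \<nu> j \<ge> 0) \<and> \<nu> J = 0 \<and>
     0 = \<pi> 0 * (lam1 + 2 * lam2 * x 0) + \<nu> 0 \<and>
     (\<forall>j\<in>{1..J}. \<omega> j * \<xi> j = \<pi> j * (lam1 + 2 * lam2 * x j) + (\<nu> j - \<nu> (j - 1))) \<and>
     (\<forall>j<J. \<nu> j * (x (j + 1) - x j) = 0)"

definition base_level :: "real \<Rightarrow> real \<Rightarrow> real" where
  "base_level lam1 lam2 = - lam1 / (2 * lam2)"

definition level_candidate ::
    "(nat \<Rightarrow> real) \<Rightarrow> (nat \<Rightarrow> real) \<Rightarrow> real \<Rightarrow> real \<Rightarrow> (nat \<Rightarrow> real) \<Rightarrow> nat \<Rightarrow> real" where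
  "level_candidate \<omega> \<pi> lam1 lam2 \<xi> j =
     (if j = 0 then base_level lam1 lam2
      else base_level lam1 lam2 + \<omega> j * \<xi> j / (2 * lam2 * \<pi> j))"


section \<open>Isotonic regression and pooling of adjacent violators\<close>

text \<open>\<open>x 0, \<dots>, x (n - 1)\<close> is the (unique) \<open>w\<close>-weighted isotonic regression of
  \<open>r 0, \<dots>, r (n - 1)\<close>.\<close>

definition isotonic_regression ::
    "nat \<Rightarrow> (nat \<Rightarrow> real) \<Rightarrow> (nat \<Rightarrow> real) \<Rightarrow> (nat \<Rightarrow> real) \<Rightarrow> bool" where
  "isotonic_regression n w r x \<longleftrightarrow>
     mono_on {..<n} x \<and>
     (\<forall>y. mono_on {..<n} y \<longrightarrow>
        (\<Sum>j<n. w j * (x j - r j)\<^sup>2) \<le> (\<Sum>j<n. w j * (y j - r j)\<^sup>2) \<and>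
        ((\<Sum>j<n. w j * (y j - r j)\<^sup>2) = (\<Sum>j<n. w j * (x j - r j)\<^sup>2)
           \<longrightarrow> (\<forall>j<n. y j = x j)))"

text \<open>The input is a list of pairs (value, weight). A block \<open>(v, w, k)\<close> stands for \<open>k\<close> consecutive
  entries pooled to their weighted mean \<open>v\<close>, with total weight \<open>w\<close>. Blocks are kept on a stack whose
  head is the rightmost block.\<close>

type_synonym block = "real \<times> real \<times> nat"

fun pava_push :: "block \<Rightarrow> block list \<Rightarrow> block list" where
  "pava_push (v, w, k) [] = [(v, w, k)]"
| "pava_push (v, w, k) ((v', w', k') # bs) =
     (if v' \<le> v then (v, w, k) # (v', w', k') # bs
      else pava_push ((w' * v' + w * v) / (w' + w), w' + w, k' + k) bs)"

fun pava_scan :: "block list \<Rightarrow> (real \<times> real) list \<Rightarrow> block list" where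
  "pava_scan bs [] = bs"
| "pava_scan bs ((v, w) # xs) = pava_scan (pava_push (v, w, 1) bs) xs"

fun pava_prepend :: "nat \<Rightarrow> real \<Rightarrow> real list \<Rightarrow> real list" where
  "pava_prepend 0 v ys = ys"
| "pava_prepend (Suc k) v ys = pava_prepend k v (v # ys)"

fun pava_expand :: "block list \<Rightarrow> real list \<Rightarrow> real list" where
  "pava_expand [] ys = ys"
| "pava_expand ((v, w, k) # bs) ys = pava_expand bs (pava_prepend k v ys)"

definition pava :: "(real \<times> real) list \<Rightarrow> real list" where
  "pava xs = pava_expand (pava_scan [] xs) []"

text \<open>Running times, in the style of \<open>HOL-Library.Time_Commands\<close>: every call of one of the
  functions above costs one step, while arithmetic, comparisons and constructors are free.\<close>

fun T_pava_push :: "block \<Rightarrow> block list \<Rightarrow> nat" where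
  "T_pava_push (v, w, k) [] = 1"
| "T_pava_push (v, w, k) ((v', w', k') # bs) =
     (if v' \<le> v then 0
      else T_pava_push ((w' * v' + w * v) / (w' + w), w' + w, k' + k) bs) + 1"

fun T_pava_scan :: "block list \<Rightarrow> (real \<times> real) list \<Rightarrow> nat" where
  "T_pava_scan bs [] = 1"
| "T_pava_scan bs ((v, w) # xs) =
     T_pava_push (v, w, 1) bs + T_pava_scan (pava_push (v, w, 1) bs) xs + 1"

fun T_pava_prepend :: "nat \<Rightarrow> real \<Rightarrow> real list \<Rightarrow> nat" where
  "T_pava_prepend 0 v ys = 1"
| "T_pava_prepend (Suc k) v ys = T_pava_prepend k v (v # ys) + 1"

fun T_pava_expand :: "block list \<Rightarrow> real list \<Rightarrow> nat" where
  "T_pava_expand [] ys = 1"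
| "T_pava_expand ((v, w, k) # bs) ys =
     T_pava_prepend k v ys + T_pava_expand bs (pava_prepend k v ys) + 1"

definition T_pava :: "(real \<times> real) list \<Rightarrow> nat" where
  "T_pava xs = T_pava_scan [] xs + T_pava_expand (pava_scan [] xs) [] + 1"

end

theory Submission
  imports Defs
begin

text \<open>
  The utility \<open>U\<close> is nondecreasing and the bulk level \<open>c\<^sub>0\<close> does not enter the objective. These two
  facts reduce the infinite-dimensional problem to the finite program. Given a quantile function
  \<open>q\<close> with the prescribed moments, replace it on each piece \<open>[p\<^sub>j, p\<^sub>j\<^sub>+\<^sub>1)\<close> by its average. Since
  \<open>q\<close> is nondecreasing, the average is at least \<open>q(p\<^sub>j)\<close>, so the credit does not fall; the mean is
  unchanged; by Jensen's inequality the second moment can only drop. The lost variance is put back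
  without loss of credit by lowering the bulk level and raising the top level until the second
  moment is right (\<open>program_feasible_dominating\<close>, \<open>program_feasible_above_quantile\<close>). Hence the
  value of the program bounds both suprema, and the staircase through an optimal level vector, or the
  law of this staircase under the uniform distribution, attains it. A law enters through its lower
  quantile function, which has the law as its distribution under the uniform law and is at
  least the upper quantile at \<open>p\<^sub>j\<close> at every point to the right of \<open>p\<^sub>j\<close> (\<open>program_feasible_above_load\<close>). The
  program has a solution because its feasible set is compact.

  For the multipliers, let \<open>x\<close> be optimal and let \<open>d\<close> be a direction that respects the linearized
  constraints. The curve \<open>m + s(t) (x + t d - m)\<close> with \<open>s(t) = \<sigma> / sqrt (\<sigma>\<^sup>2 + t\<^sup>2 \<Sum>\<^sub>j \<pi>\<^sub>j d\<^sub>j\<^sup>2)\<close> stays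
  exactly feasible for small \<open>t \<ge> 0\<close> and has velocity \<open>d\<close> at \<open>0\<close>; it exists because \<open>\<sigma> > 0\<close>. Along it the objective
  cannot increase. As \<open>U\<close> is affine on both sides of every point, with slopes \<open>l\<close> and \<open>r\<close> say, its
  directional derivative is at least \<open>min (l h) (r h)\<close>, at concave and at convex kinks alike, so
  \<open>\<Sum>\<^sub>j \<omega>\<^sub>j min (l\<^sub>j d\<^sub>j) (r\<^sub>j d\<^sub>j) \<le> 0\<close> on a polyhedral cone (\<open>program_first_order\<close>). With an auxiliary
  variable for each minimum this is a linear implication, and Farkas' lemma turns it into multipliers;
  the weights of the two slopes give a convex combination of \<open>l\<^sub>j\<close> and \<open>r\<^sub>j\<close>, and the segment between
  the one-sided slopes lies in the Clarke subdifferential.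

  If \<open>\<lambda>\<^sub>2 > 0\<close>, then up to the factor \<open>2 \<lambda>\<^sub>2\<close> the \<open>\<nu>\<^sub>j\<close> are the partial sums of the weighted residuals
  \<open>\<pi>\<^sub>j (R\<^sub>j - c\<^sub>j)\<close>. Summation by parts then gives the variational inequality that characterizes the
  isotonic regression. The output of the pool-adjacent-violators algorithm satisfies the same
  inequality, block by block, and the isotonic regression is unique. The algorithm is linear because
  each entry enters the stack once and each merge removes a block from it.
\<close>

section \<open>Isotonic regression\<close>

lemma sum_lessThan_add:
  fixes f :: "nat \<Rightarrow> real"
  shows "(\<Sum>i<m + n. f i) = (\<Sum>i<m. f i) + (\<Sum>i<n. f (m + i))"
  by (induction n) (simp_all add: add.assoc)

lemma summation_by_parts:
  fixes a z :: "nat \<Rightarrow> real"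
  shows "(\<Sum>i<Suc n. a i * z i) =
    (\<Sum>i<Suc n. a i) * z n - (\<Sum>i<n. (\<Sum>l<Suc i. a l) * (z (Suc i) - z i))"
proof (induction n)
  case (Suc n)
  have "(\<Sum>i<Suc (Suc n). a i * z i) = (\<Sum>i<Suc n. a i * z i) + a (Suc n) * z (Suc n)"
    by simp
  also have "\<dots> = (\<Sum>i<Suc n. a i) * z n - (\<Sum>i<n. (\<Sum>l<Suc i. a l) * (z (Suc i) - z i))
      + a (Suc n) * z (Suc n)"
    using Suc.IH by simp
  finally show ?case
    by (simp add: algebra_simps)
qed simp

text \<open>Summation by parts turns the sum into minus a combination of the increments of \<open>z\<close>, with the
  prefix sums of \<open>a\<close> as coefficients.\<close>

lemma sum_prefix_nonneg_mono:
  fixes a z :: "nat \<Rightarrow> real"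
  assumes prefix: "\<And>l. l \<le> n \<Longrightarrow> 0 \<le> (\<Sum>i<l. a i)"
    and total: "(\<Sum>i<n. a i) = 0" and z: "mono_on {..<n} z"
  shows "(\<Sum>i<n. a i * z i) \<le> 0"
proof (cases n)
  case (Suc k)
  have "0 \<le> (\<Sum>i<k. (\<Sum>l<Suc i. a l) * (z (Suc i) - z i))"
  proof (rule sum_nonneg)
    fix i assume "i \<in> {..<k}"
    then have "0 \<le> (\<Sum>l<Suc i. a l)" "0 \<le> z (Suc i) - z i"
      using prefix[of "Suc i"] mono_onD[OF z, of i "Suc i"] Suc by simp_all
    then show "0 \<le> (\<Sum>l<Suc i. a l) * (z (Suc i) - z i)"
      by (rule mult_nonneg_nonneg)
  qed
  then show ?thesis
    using summation_by_parts[of a z k] total unfolding Suc by simp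
qed simp

text \<open>Expanding the weighted squared distance to \<open>r\<close> about \<open>x\<close> leaves a linear term, whose sign is the
  variational inequality, and a positive definite quadratic term, which gives uniqueness.\<close>

lemma isotonic_regression_variational:
  assumes x: "mono_on {..<n} x" and w: "\<And>j. j < n \<Longrightarrow> 0 < w j"
    and vi: "\<And>y. mono_on {..<n} y \<Longrightarrow> (\<Sum>j<n. w j * (r j - x j) * (y j - x j)) \<le> 0"
  shows "isotonic_regression n w r x"
  unfolding isotonic_regression_def
proof (intro conjI allI impI x)
  fix y :: "nat \<Rightarrow> real" assume y: "mono_on {..<n} y"
  have eq: "(\<Sum>j<n. w j * (y j - r j)\<^sup>2) =
    (\<Sum>j<n. w j * (x j - r j)\<^sup>2) - 2 * (\<Sum>j<n. w j * (r j - x j) * (y j - x j))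
      + (\<Sum>j<n. w j * (y j - x j)\<^sup>2)"
    unfolding sum_distrib_left sum.distrib[symmetric] sum_subtractf[symmetric]
    by (intro sum.cong) (auto simp: power2_eq_square algebra_simps)
  have nonneg: "0 \<le> w j * (y j - x j)\<^sup>2" if "j < n" for j
    using w[OF that] by simp
  then have pos: "0 \<le> (\<Sum>j<n. w j * (y j - x j)\<^sup>2)"
    by (intro sum_nonneg) auto
  show "(\<Sum>j<n. w j * (x j - r j)\<^sup>2) \<le> (\<Sum>j<n. w j * (y j - r j)\<^sup>2)"
    using eq pos vi[OF y] by linarith
  assume "(\<Sum>j<n. w j * (y j - r j)\<^sup>2) = (\<Sum>j<n. w j * (x j - r j)\<^sup>2)"
  then have zero: "(\<Sum>j<n. w j * (y j - x j)\<^sup>2) = 0"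
    using eq pos vi[OF y] by linarith
  fix j assume j: "j < n"
  have "w j * (y j - x j)\<^sup>2 = 0"
    using zero j nonneg by (subst (asm) sum_nonneg_eq_0_iff) auto
  then show "y j = x j"
    using w[OF j] by simp
qed

lemma isotonic_regression_unique:
  assumes "isotonic_regression n w r x" "isotonic_regression n w r y" "j < n"
  shows "y j = x j"
proof -
  have "(\<Sum>j<n. w j * (y j - r j)\<^sup>2) = (\<Sum>j<n. w j * (x j - r j)\<^sup>2)"
    using assms unfolding isotonic_regression_def by (meson order_antisym)
  then show ?thesis
    using assms unfolding isotonic_regression_def by blast
qed

section \<open>Pooling adjacent violators\<close>

text \<open>The weighted sum of the residuals of the entries against the constant level \<open>v\<close>; it vanishes when
  \<open>v\<close> is the weighted mean.\<close>

definition excess :: "real \<Rightarrow> (real \<times> real) list \<Rightarrow> real" where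
  "excess v xs = (\<Sum>(r, w)\<leftarrow>xs. w * (r - v))"

text \<open>The optimality condition for the constant fit \<open>v\<close> to a segment: with nonnegative prefix sums and
  total zero, the residuals pair nonpositively with every nondecreasing vector.\<close>

definition poolable :: "real \<Rightarrow> (real \<times> real) list \<Rightarrow> bool" where
  "poolable v xs \<longleftrightarrow> excess v xs = 0 \<and> (\<forall>ys zs. xs = ys @ zs \<longrightarrow> 0 \<le> excess v ys)"

lemma excess_append: "excess v (xs @ ys) = excess v xs + excess v ys"
  by (simp add: excess_def)

lemma excess_shift: "excess v xs = excess u xs + (u - v) * sum_list (map snd xs)"
  by (induction xs) (auto simp: excess_def algebra_simps)

lemma excess_sum:
  "l \<le> length xs \<Longrightarrow> excess v (take l xs) = (\<Sum>i<l. snd (xs ! i) * (fst (xs ! i) - v))"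
  by (induction l) (auto simp: excess_def take_Suc_conv_app_nth case_prod_beta)

lemma sum_list_snd_nonneg: "\<forall>e\<in>set xs. 0 < snd e \<Longrightarrow> 0 \<le> (\<Sum>x\<leftarrow>xs. snd x :: real)"
  by (induction xs) auto

lemma sum_list_snd_pos:
  "xs \<noteq> [] \<Longrightarrow> \<forall>e\<in>set xs. 0 < snd e \<Longrightarrow> 0 < (\<Sum>x\<leftarrow>xs. snd x :: real)"
  by (cases xs) (auto intro!: add_pos_nonneg sum_list_snd_nonneg)

lemma poolable_singleton: "poolable v [(v, w)]"
  by (auto simp: poolable_def excess_def Cons_eq_append_conv)

text \<open>The pooled mean lies strictly between the two means. A prefix that ends in the left part can
  only gain excess, since the level falls there. A prefix that ends in the right part is measured by the
  remaining suffix: its excess against \<open>v\<close> is nonpositive and can only fall as the level rises.\<close>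

lemma poolable_append:
  fixes u v W V :: real
  assumes xs: "poolable u xs" and ys: "poolable v ys" and violation: "v < u"
    and W: "W = sum_list (map snd xs)" "W > 0" and V: "V = sum_list (map snd ys)" "V > 0"
    and pos: "\<forall>e\<in>set (xs @ ys). 0 < snd e"
  shows "poolable ((W * u + V * v) / (W + V)) (xs @ ys)"
proof -
  define t where "t = (W * u + V * v) / (W + V)"
  have "t * (W + V) = W * u + V * v"
    using W V by (simp add: t_def)
  then have t: "(u - t) * W + (v - t) * V = 0"
    by (simp add: algebra_simps)
  have "v < t" "t < u"
    using W V violation by (simp_all add: t_def field_simps)
  have total: "excess t (xs @ ys) = 0"
    using xs ys t excess_shift[of t xs u] excess_shift[of t ys v]
    by (simp add: excess_append poolable_def W(1) V(1))
  have "0 \<le> excess t us" if eq: "xs @ ys = us @ vs" for us vs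
  proof -
    consider ds where "xs = us @ ds" | ds where "us = xs @ ds" "ys = ds @ vs"
      using eq by (auto simp: append_eq_append_conv2)
    then show ?thesis
    proof cases
      case 1
      then have "0 \<le> excess u us" "0 \<le> sum_list (map snd us)"
        using xs pos by (auto simp: poolable_def intro!: sum_list_snd_nonneg)
      then show ?thesis
        using excess_shift[of t us u] \<open>t < u\<close> by simp
    next
      case 2
      have "excess v vs \<le> 0"
        using ys 2(2) excess_append[of v ds vs] by (auto simp: poolable_def)
      moreover have "0 \<le> sum_list (map snd vs)"
        using pos 2(2) by (auto intro!: sum_list_snd_nonneg)
      ultimately have "excess t vs \<le> 0"
        using excess_shift[of t vs v] \<open>v < t\<close>
        by (simp add: mult_nonpos_nonneg add_nonpos_nonpos)
      then show ?thesis
        using total excess_append[of t us vs] eq by simp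
    qed
  qed
  with total show ?thesis
    by (simp add: poolable_def t_def)
qed

lemma poolable_variational:
  assumes pool: "poolable v xs" and z: "mono_on {..<length xs} z"
  shows "(\<Sum>i<length xs. snd (xs ! i) * (fst (xs ! i) - v) * (z i - v)) \<le> 0"
proof -
  let ?a = "\<lambda>i. snd (xs ! i) * (fst (xs ! i) - v)"
  have "0 \<le> (\<Sum>i<l. ?a i)" if "l \<le> length xs" for l
    using pool excess_sum[OF that, of v] append_take_drop_id[of l xs, symmetric]
    unfolding poolable_def by metis
  moreover have "(\<Sum>i<length xs. ?a i) = 0"
    using pool excess_sum[of "length xs" xs v] by (simp add: poolable_def)
  moreover have "mono_on {..<length xs} (\<lambda>i. z i - v)"
    using z by (auto simp: mono_on_def)
  ultimately show ?thesis
    by (rule sum_prefix_nonneg_mono)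
qed

text \<open>The invariant of the scan: the stack cuts the entries read so far into consecutive poolable
  segments, and no level exceeds the level of the block above it.\<close>

inductive pooled :: "(real \<times> real) list \<Rightarrow> block list \<Rightarrow> bool" where
  pooled_Nil: "pooled [] []"
| pooled_Cons: "pooled xs bs \<Longrightarrow> seg \<noteq> [] \<Longrightarrow> poolable v seg \<Longrightarrow>
    (bs \<noteq> [] \<Longrightarrow> fst (hd bs) \<le> v) \<Longrightarrow>
    pooled (xs @ seg) ((v, sum_list (map snd seg), length seg) # bs)"

text \<open>The block that is being pushed may violate the order of the levels, so it stays outside the
  invariant until no violation is left; each merge passes a longer poolable segment to the next call.\<close>

lemma pooled_push:
  assumes "pooled xs bs" "seg \<noteq> []" "poolable v seg"
    and "w = sum_list (map snd seg)" "k = length seg"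
    and "\<forall>e\<in>set (xs @ seg). 0 < snd e"
  shows "pooled (xs @ seg) (pava_push (v, w, k) bs)"
  using assms
proof (induction "(v, w, k)" bs arbitrary: v w k seg xs rule: pava_push.induct)
  case (1 v w k)
  then show ?case
    using pooled_Cons[of xs "[]" seg v] by simp
next
  case (2 v w k v' w' k' bs)
  show ?case
  proof (cases "v' \<le> v")
    case True
    then show ?thesis
      using pooled_Cons[of xs "(v', w', k') # bs" seg v] 2 by simp
  next
    case False
    from \<open>pooled xs ((v', w', k') # bs)\<close> obtain ys seg' where ys: "xs = ys @ seg'" "pooled ys bs"
      "seg' \<noteq> []" "poolable v' seg'" "w' = sum_list (map snd seg')" "k' = length seg'"
      by cases auto
    have w': "0 < w'" "0 < w"
      unfolding ys(5) \<open>w = _\<close> using ys 2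
      by (auto intro!: sum_list_snd_pos)
    have "poolable ((w' * v' + w * v) / (w' + w)) (seg' @ seg)"
      using False ys 2 w' by (intro poolable_append) auto
    then have "pooled (ys @ (seg' @ seg))
        (pava_push ((w' * v' + w * v) / (w' + w), w' + w, k' + k) bs)"
      using False ys 2 by (intro 2(1)) auto
    with False ys show ?thesis
      by simp
  qed
qed

lemma pooled_scan:
  assumes "pooled ys bs" "\<forall>e\<in>set (ys @ xs). 0 < snd e"
  shows "pooled (ys @ xs) (pava_scan bs xs)"
  using assms
proof (induction bs xs arbitrary: ys rule: pava_scan.induct)
  case (2 bs v w xs)
  have "pooled (ys @ [(v, w)]) (pava_push (v, w, 1) bs)"
    using 2 by (intro pooled_push) (auto simp: poolable_singleton)
  then have "pooled ((ys @ [(v, w)]) @ xs) (pava_scan (pava_push (v, w, 1) bs) xs)"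
    using 2 by (intro 2(1)) auto
  then show ?case
    by simp
qed simp

lemma pava_prepend_replicate: "pava_prepend k v ys = replicate k v @ ys"
  by (induction k v ys rule: pava_prepend.induct) (simp_all add: replicate_app_Cons_same)

lemma pava_expand_append: "pava_expand bs ys = pava_expand bs [] @ ys"
proof (induction bs arbitrary: ys)
  case (Cons b bs)
  obtain v w k where b: "b = (v, w, k)"
    by (cases b) auto
  show ?case
    unfolding b using Cons.IH[of "replicate k v @ ys"] Cons.IH[of "replicate k v"]
    by (simp add: pava_prepend_replicate)
qed simp

lemma pava_expand_Cons: "pava_expand ((v, w, k) # bs) [] = pava_expand bs [] @ replicate k v"
  using pava_expand_append[of bs "replicate k v"] by (simp add: pava_prepend_replicate)

lemma pooled_length: "pooled xs bs \<Longrightarrow> length (pava_expand bs []) = length xs"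
  by (induction rule: pooled.induct) (simp_all add: pava_expand_Cons del: pava_expand.simps(2))

lemma pooled_sorted:
  "pooled xs bs \<Longrightarrow> sorted (pava_expand bs []) \<and>
     (bs \<noteq> [] \<longrightarrow> (\<forall>y\<in>set (pava_expand bs []). y \<le> fst (hd bs)))"
  by (induction rule: pooled.induct)
    (force simp add: pava_expand_Cons sorted_append simp del: pava_expand.simps(2))+

text \<open>Each block contributes a nonpositive amount for every test vector that is monotone on the block,
  so the inequality adds up over the blocks without comparing their levels.\<close>

lemma pooled_variational:
  assumes "pooled xs bs" "mono_on {..<length xs} z"
  shows "(\<Sum>i<length xs. snd (xs ! i) * (fst (xs ! i) - pava_expand bs [] ! i) *
    (z i - pava_expand bs [] ! i)) \<le> 0"
  using assms
proof (induction arbitrary: z rule: pooled.induct)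
  case (pooled_Cons xs bs seg v)
  let ?n = "length xs" and ?e = "pava_expand bs []"
  note len = pooled_length[OF pooled_Cons.hyps(1)]
  have "(\<Sum>i<?n. snd (xs ! i) * (fst (xs ! i) - ?e ! i) * (z i - ?e ! i)) \<le> 0"
    using pooled_Cons.prems by (intro pooled_Cons.IH) (auto simp: mono_on_def)
  moreover have "(\<Sum>i<length seg. snd (seg ! i) * (fst (seg ! i) - v) * (z (?n + i) - v)) \<le> 0"
    using pooled_Cons.prems
    by (intro poolable_variational pooled_Cons) (auto simp: mono_on_def)
  ultimately show ?case
    by (simp add: sum_lessThan_add nth_append len pava_expand_Cons del: pava_expand.simps(2))
qed simp

lemma pava_isotonic_regression:
  assumes pos: "\<forall>e\<in>set xs. 0 < snd e"
  shows "length (pava xs) = length xs"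
    and "isotonic_regression (length xs) (\<lambda>j. snd (xs ! j)) (\<lambda>j. fst (xs ! j)) (\<lambda>j. pava xs ! j)"
proof -
  have pool: "pooled xs (pava_scan [] xs)"
    using pooled_scan[OF pooled_Nil, of xs] pos by simp
  show len: "length (pava xs) = length xs"
    using pooled_length[OF pool] by (simp add: pava_def)
  show "isotonic_regression (length xs) (\<lambda>j. snd (xs ! j)) (\<lambda>j. fst (xs ! j)) (\<lambda>j. pava xs ! j)"
  proof (rule isotonic_regression_variational)
    show "mono_on {..<length xs} (\<lambda>j. pava xs ! j)"
      using pooled_sorted[OF pool] len
      by (auto simp: mono_on_def pava_def intro: sorted_nth_mono)
    show "0 < snd (xs ! j)" if "j < length xs" for j
      using pos that by simp
    show "(\<Sum>j<length xs. snd (xs ! j) * (fst (xs ! j) - pava xs ! j) * (y j - pava xs ! j)) \<le> 0"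
      if "mono_on {..<length xs} y" for y
      using pooled_variational[OF pool that] by (simp add: pava_def)
  qed
qed

text \<open>Pooling computes the isotonic regression, which is unique.\<close>

lemma isotonic_regression_eq_pava:
  assumes iso: "isotonic_regression n w r x" and w: "\<And>j. j < n \<Longrightarrow> 0 < w j"
  shows "pava (map (\<lambda>j. (r j, w j)) [0..<n]) = map x [0..<n]"
proof -
  let ?xs = "map (\<lambda>j. (r j, w j)) [0..<n]"
  have pos: "\<forall>e\<in>set ?xs. 0 < snd e"
    using w by auto
  note len = pava_isotonic_regression(1)[OF pos]
  have sums: "(\<Sum>j<n. snd (?xs ! j) * (z j - fst (?xs ! j))\<^sup>2) = (\<Sum>j<n. w j * (z j - r j)\<^sup>2)" for z
    by (intro sum.cong) auto
  have "isotonic_regression n w r (\<lambda>j. pava ?xs ! j)"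
    using pava_isotonic_regression(2)[OF pos,
        unfolded isotonic_regression_def length_map length_upt diff_zero sums]
    unfolding isotonic_regression_def by blast
  then have "pava ?xs ! j = x j" if "j < n" for j
    using isotonic_regression_unique[OF iso] that by blast
  then show ?thesis
    using len by (intro nth_equalityI) auto
qed

section \<open>Running time of pooling\<close>

text \<open>The length of the stack serves as a potential: every recursive call removes one block.\<close>

lemma T_pava_push: "T_pava_push b bs + length (pava_push b bs) = length bs + 2"
  by (induction b bs rule: pava_push.induct) auto

lemma T_pava_scan:
  "T_pava_scan bs xs + length (pava_scan bs xs) = length bs + 3 * length xs + 1"
proof (induction bs xs rule: pava_scan.induct)
  case (2 bs v w xs)
  then show ?case
    using T_pava_push[of "(v, w, 1)" bs] by simp
qed simp

lemma T_pava_prepend: "T_pava_prepend k v ys = k + 1"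
  by (induction k v ys rule: T_pava_prepend.induct) simp_all

text \<open>Blocks are nonempty, so there are at most as many blocks as entries.\<close>

lemma T_pava_expand:
  "pooled xs bs \<Longrightarrow> T_pava_expand bs ys \<le> 3 * length xs + 1"
proof (induction arbitrary: ys rule: pooled.induct)
  case (pooled_Cons xs bs seg v)
  have "1 \<le> length seg"
    using pooled_Cons.hyps(2) by (cases seg) auto
  then show ?case
    using pooled_Cons.IH[of "pava_prepend (length seg) v ys"] by (simp add: T_pava_prepend)
qed simp

lemma T_pava_linear:
  assumes "xs \<noteq> []" and pos: "\<forall>e\<in>set xs. 0 < snd e"
  shows "T_pava xs \<le> 9 * length xs"
proof -
  have "pooled xs (pava_scan [] xs)"
    using pooled_scan[OF pooled_Nil, of xs] pos by simp
  then have "T_pava_expand (pava_scan [] xs) [] \<le> 3 * length xs + 1"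
    by (rule T_pava_expand)
  moreover have "T_pava_scan [] xs \<le> 3 * length xs + 1"
    using T_pava_scan[of "[]" xs] by simp
  moreover have "1 \<le> length xs"
    using \<open>xs \<noteq> []\<close> by (cases xs) auto
  ultimately show ?thesis
    by (simp add: T_pava_def)
qed

section \<open>One-sided slopes and the Clarke subdifferential\<close>

text \<open>The one-sided slopes \<open>l\<close> and \<open>r\<close> at \<open>x\<close>, as an exact identity near \<open>x\<close> instead of a limit: a
  piecewise affine function has no error term.\<close>

definition kink :: "(real \<Rightarrow> real) \<Rightarrow> real \<Rightarrow> real \<Rightarrow> real \<Rightarrow> bool" where
  "kink f x l r \<longleftrightarrow> (\<forall>\<^sub>F h in nhds 0. f (x + h) = f x + (if 0 \<le> h then r else l) * h)"

lemma kink_ramp: "\<exists>l r. kink (\<lambda>y. max (y - a) 0) x l r"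
proof (cases "x = a")
  case True
  then show ?thesis
    by (intro exI[of _ 0] exI[of _ 1]) (auto simp: kink_def)
next
  case False
  have "\<forall>\<^sub>F h in nhds 0. \<bar>h\<bar> < \<bar>x - a\<bar>"
    unfolding eventually_nhds_metric using False by (intro exI[of _ "\<bar>x - a\<bar>"]) auto
  then have "kink (\<lambda>y. max (y - a) 0) x (if x < a then 0 else 1) (if x < a then 0 else 1)"
    unfolding kink_def by eventually_elim auto
  then show ?thesis
    by blast
qed

lemma kink_cmult_diff:
  assumes "kink f x l r" "kink f' x l' r'"
  shows "kink (\<lambda>y. c * (f y - f' y)) x (c * (l - l')) (c * (r - r'))"
  using assms unfolding kink_def by eventually_elim (auto simp: algebra_simps)

lemma kink_sum:
  assumes "\<And>k. k \<in> S \<Longrightarrow> kink (f k) x (l k) (r k)" "finite S"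
  shows "kink (\<lambda>y. \<Sum>k\<in>S. f k y) x (sum l S) (sum r S)"
proof -
  have "\<forall>\<^sub>F h in nhds 0. \<forall>k\<in>S. f k (x + h) = f k x + (if 0 \<le> h then r k else l k) * h"
    using assms unfolding kink_def by (simp add: eventually_ball_finite_distrib)
  then show ?thesis
    unfolding kink_def
    by eventually_elim (auto simp: sum.distrib sum_distrib_right)
qed

lemma kink_credit_utility: "\<exists>l r. kink (credit_utility K a b g) x l r"
proof -
  obtain l r where lr: "kink (\<lambda>y. max (y - a k) 0) x (l k) (r k)" for k
    using kink_ramp[of "a _" x] by metis
  obtain l' r' where lr': "kink (\<lambda>y. max (y - b k) 0) x (l' k) (r' k)" for k
    using kink_ramp[of "b _" x] by metis
  have "kink (\<lambda>y. \<Sum>k=1..K. g k * (max (y - a k) 0 - max (y - b k) 0)) x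
      (\<Sum>k=1..K. g k * (l k - l' k)) (\<Sum>k=1..K. g k * (r k - r' k))"
    by (intro kink_sum kink_cmult_diff lr lr') auto
  then show ?thesis
    unfolding credit_utility_def[abs_def] by blast
qed

text \<open>The base points of the difference quotients range over neighbourhoods of \<open>x\<close>. At a base point
  near which \<open>f\<close> is affine with slope \<open>s\<close>, all quotients with a small step equal \<open>s * h\<close>.\<close>

lemma clarke_derivative_ge_nearby_slope:
  fixes f :: "real \<Rightarrow> real"
  assumes slope: "\<And>d. 0 < d \<Longrightarrow>
      \<exists>y. \<bar>y - x\<bar> < d \<and> (\<forall>\<^sub>F h in nhds 0. f (y + h) = f y + s * h)"
  shows "ereal (s * h) \<le> clarke_derivative f x h"
proof (rule ccontr)
  assume "\<not> ?thesis"
  then have "\<forall>\<^sub>F z in nhds x \<times>\<^sub>F at_right 0.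
      (case z of (y, t) \<Rightarrow> ereal ((f (y + t * h) - f y) / t)) < ereal (s * h)"
    unfolding clarke_derivative_def not_le by (rule Limsup_lessD)
  then obtain P Q where P: "eventually P (nhds x)" and Q: "eventually Q (at_right (0::real))"
    and less: "\<And>y t. P y \<Longrightarrow> Q t \<Longrightarrow> (f (y + t * h) - f y) / t < s * h"
    unfolding eventually_prod_filter by auto
  from P obtain d where "0 < d" and d: "\<And>y. \<bar>y - x\<bar> < d \<Longrightarrow> P y"
    unfolding eventually_nhds_metric dist_real_def by blast
  obtain y where y: "\<bar>y - x\<bar> < d" "\<forall>\<^sub>F h in nhds 0. f (y + h) = f y + s * h"
    using slope[OF \<open>0 < d\<close>] by blast
  have "((\<lambda>t. t * h) \<longlongrightarrow> 0 * h) (at_right 0)"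
    by (intro tendsto_intros)
  then have "\<forall>\<^sub>F t in at_right 0. f (y + t * h) = f y + s * (t * h)"
    using eventually_compose_filterlim[OF y(2)] by simp
  then have "\<forall>\<^sub>F t in at_right (0::real). False"
    using Q eventually_at_right_less[of 0]
    by eventually_elim (use less[OF d[OF y(1)]] in fastforce)
  then show False
    by simp
qed

lemma kink_nearby_slopes:
  assumes "kink f x l r" "s = l \<or> s = r" "0 < d"
  shows "\<exists>y. \<bar>y - x\<bar> < d \<and> (\<forall>\<^sub>F h in nhds 0. f (y + h) = f y + s * h)"
proof -
  obtain e where "0 < e" and
    e: "\<And>h. \<bar>h\<bar> < e \<Longrightarrow> f (x + h) = f x + (if 0 \<le> h then r else l) * h"
    using assms(1) unfolding kink_def eventually_nhds_metric dist_real_def by force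
  define \<delta> where "\<delta> = min d e / 2"
  \<comment> \<open>a step to the side of \<open>x\<close> on which the slope is \<open>s\<close>\<close>
  define z where "z = (if s = r then \<delta> else - \<delta>)"
  have \<delta>: "0 < \<delta>" "\<delta> < d" "2 * \<delta> \<le> e"
    using \<open>0 < d\<close> \<open>0 < e\<close> by (auto simp: \<delta>_def)
  have "\<forall>\<^sub>F h in nhds 0. \<bar>h\<bar> < \<delta>"
    unfolding eventually_nhds_metric using \<delta> by (intro exI[of _ \<delta>]) auto
  then have "\<forall>\<^sub>F h in nhds 0. f (x + z + h) = f (x + z) + s * h"
  proof eventually_elim
    case (elim h)
    then have "\<bar>z\<bar> < e" "\<bar>z + h\<bar> < e" "(if 0 \<le> z then r else l) = s"
        "(if 0 \<le> z + h then r else l) = s"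
      using \<delta> assms(2) by (auto simp: z_def)
    then have "f (x + z) = f x + s * z" "f (x + (z + h)) = f x + s * (z + h)"
      using e[of z] e[of "z + h"] by simp_all
    then show ?case
      by (simp add: algebra_simps)
  qed
  then show ?thesis
    using \<delta> by (intro exI[of _ "x + z"]) (auto simp: z_def)
qed

text \<open>Both one-sided slopes occur as slopes at points near \<open>x\<close>, and \<open>v * h\<close> is at most one of
  \<open>l * h\<close> and \<open>r * h\<close>. This covers concave kinks and convex kinks alike.\<close>

lemma kink_clarke_subdifferential:
  assumes kink: "kink f x l r" and v: "min l r \<le> v" "v \<le> max l r"
  shows "v \<in> clarke_subdifferential f x"
  unfolding clarke_subdifferential_def
proof (intro CollectI allI)
  fix h
  have slopes: "ereal (l * h) \<le> clarke_derivative f x h" "ereal (r * h) \<le> clarke_derivative f x h"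
    using kink_nearby_slopes[OF kink] by (auto intro!: clarke_derivative_ge_nearby_slope)
  have "v * h \<le> max l r * h \<or> v * h \<le> min l r * h"
    using v by (cases "0 \<le> h") (auto intro: mult_right_mono mult_right_mono_neg)
  then have "v * h \<le> l * h \<or> v * h \<le> r * h"
    by (auto simp: max_def min_def split: if_splits)
  with slopes show "ereal (v * h) \<le> clarke_derivative f x h"
    by (auto intro: order_trans[rotated])
qed

section \<open>The credit utility\<close>

locale credit_steps =
  fixes K :: nat and a b g :: "nat \<Rightarrow> real"
  assumes K: "K \<ge> 1"
    and ab: "\<And>k. k \<in> {1..K} \<Longrightarrow> a k < b k"
    and ba: "\<And>k. k \<in> {1..<K} \<Longrightarrow> b k \<le> a (k + 1)"
    and g: "\<And>k. k \<in> {1..K} \<Longrightarrow> g k > 0"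
begin

abbreviation "U \<equiv> credit_utility K a b g"

lemma a_ge_first: "k \<in> {1..K} \<Longrightarrow> a 1 \<le> a k"
proof (induction k)
  case (Suc k)
  then show ?case
    using ab[of k] ba[of k] by (cases "k = 0") auto
qed simp

lemma b_le_last:
  assumes "k \<in> {1..K}"
  shows "b k \<le> b K"
proof -
  have "k \<le> K" using assms by simp
  then show ?thesis
  proof (induction k rule: inc_induct)
    case (step n)
    then show ?case
      using ab[of "Suc n"] ba[of n] assms by (cases "n = 0") auto
  qed simp
qed

lemma U_mono: "x \<le> y \<Longrightarrow> U x \<le> U y"
  unfolding credit_utility_def
proof (intro sum_mono mult_left_mono)
  fix k assume "x \<le> y" "k \<in> {1..K}"
  then show "max (x - a k) 0 - max (x - b k) 0 \<le> max (y - a k) 0 - max (y - b k) 0" "0 \<le> g k"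
    using ab[of k] g[of k] by auto
qed

lemma U_below: "x \<le> a 1 \<Longrightarrow> U x = 0"
  unfolding credit_utility_def
proof (intro sum.neutral ballI)
  fix k assume "x \<le> a 1" "k \<in> {1..K}"
  then show "g k * (max (x - a k) 0 - max (x - b k) 0) = 0"
    using a_ge_first[of k] ab[of k] by auto
qed

lemma U_above: "b K \<le> x \<Longrightarrow> U x = U (b K)"
  unfolding credit_utility_def
proof (intro sum.cong refl)
  fix k assume "b K \<le> x" "k \<in> {1..K}"
  then show "g k * (max (x - a k) 0 - max (x - b k) 0) =
      g k * (max (b K - a k) 0 - max (b K - b k) 0)"
    using b_le_last[of k] ab[of k] by auto
qed

lemma U_nonneg: "0 \<le> U x"
  using U_mono[of "min x (a 1)" x] U_below[of "min x (a 1)"] by simp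

lemma U_le_total: "U x \<le> U (b K)"
  using U_mono[of x "max x (b K)"] U_above[of "max x (b K)"] by simp

lemma U_continuous: "continuous_on S U"
  unfolding credit_utility_def[abs_def] by (intro continuous_intros)

lemma credit_tier_mono: "x \<le> y \<Longrightarrow> credit_tier K a b x \<le> credit_tier K a b y"
  by (auto simp: credit_tier_def less_eq_tier_def)

end

section \<open>The finite program\<close>

lemma program_feasible_mono:
  assumes "program_feasible J \<pi> \<sigma> m x" "i \<le> j" "j \<le> J"
  shows "x i \<le> x j"
  using assms(2,3)
proof (induction j rule: dec_induct)
  case (step n)
  then have "x n \<le> x (Suc n)"
    using assms(1) by (simp add: program_feasible_def)
  with step show ?case
    by simp
qed simp

locale positive_weights =
  fixes J :: nat and \<pi> :: "nat \<Rightarrow> real"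
  assumes J: "J \<ge> 1" and \<pi>_pos: "\<And>j. j \<le> J \<Longrightarrow> 0 < \<pi> j"
begin

text \<open>Variance is added without loss at the levels \<open>1, \<dots>, J\<close>: lower level \<open>0\<close> by \<open>d / \<pi> 0\<close> and raise
  level \<open>J\<close> by \<open>d / \<pi> J\<close>. This keeps the order and the mean, and the second moment grows continuously
  and without bound in \<open>d\<close>, so it passes through the prescribed value.\<close>

lemma program_feasible_dominating:
  assumes mono: "\<And>j. j < J \<Longrightarrow> x j \<le> x (j + 1)"
    and mean: "(\<Sum>j=0..J. \<pi> j * x j) = m"
    and second: "(\<Sum>j=0..J. \<pi> j * (x j)\<^sup>2) \<le> m\<^sup>2 + \<sigma>\<^sup>2"
  obtains y where "program_feasible J \<pi> \<sigma> m y" "\<And>j. j \<in> {1..J} \<Longrightarrow> x j \<le> y j"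
proof -
  \<comment> \<open>the change of the levels per unit of first moment that is moved from the bottom to the top\<close>
  define e where "e j = (if j = 0 then - 1 / \<pi> 0 else 0) + (if j = J then 1 / \<pi> J else 0)" for j
  define y where "y d j = x j + d * e j" for d j
  have pos: "0 < \<pi> 0" "0 < \<pi> J"
    using \<pi>_pos by auto
  have sum_e: "(\<Sum>j=0..J. \<pi> j * f j * e j) = f J - f 0" for f
  proof -
    have "(\<Sum>j=0..J. \<pi> j * f j * e j) =
        (\<Sum>j=0..J. (if j = 0 then - f j else 0) + (if j = J then f j else 0))"
      using pos by (intro sum.cong) (auto simp: e_def distrib_left)
    then show ?thesis
      by (simp add: sum.distrib)
  qed
  have mean_y: "(\<Sum>j=0..J. \<pi> j * y d j) = m" for d
  proof -
    have "(\<Sum>j=0..J. \<pi> j * y d j) = (\<Sum>j=0..J. \<pi> j * x j) + d * (\<Sum>j=0..J. \<pi> j * 1 * e j)"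
      unfolding sum_distrib_left sum.distrib[symmetric] y_def
      by (intro sum.cong) (auto simp: algebra_simps)
    then show ?thesis
      using mean sum_e[of "\<lambda>_. 1"] by simp
  qed
  define S where "S d = (\<Sum>j=0..J. \<pi> j * (y d j)\<^sup>2)" for d
  have S: "S d = (\<Sum>j=0..J. \<pi> j * (x j)\<^sup>2) + 2 * d * (x J - x 0) + d\<^sup>2 * (e J - e 0)" for d
  proof -
    have "S d = (\<Sum>j=0..J. \<pi> j * (x j)\<^sup>2) + 2 * d * (\<Sum>j=0..J. \<pi> j * x j * e j)
        + d\<^sup>2 * (\<Sum>j=0..J. \<pi> j * e j * e j)"
      unfolding S_def sum_distrib_left sum.distrib[symmetric] y_def
      by (intro sum.cong) (auto simp: algebra_simps power2_eq_square)
    then show ?thesis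
      by (simp add: sum_e)
  qed
  \<comment> \<open>chosen so that the contribution of level 0 alone, \<open>D\<^sup>2 / \<pi> 0\<close>, already reaches the prescribed second moment\<close>
  define D where "D = sqrt (\<pi> 0 * (m\<^sup>2 + \<sigma>\<^sup>2))"
  have "x 0 \<le> x i" if "i \<le> J" for i
    using that
  proof (induction i)
    case (Suc i)
    then show ?case
      using mono[of i] by simp
  qed simp
  then have "x 0 \<le> x J"
    by simp
  have "0 \<le> D"
    using pos by (simp add: D_def)
  have "m\<^sup>2 + \<sigma>\<^sup>2 = D\<^sup>2 * (1 / \<pi> 0)"
    using pos by (simp add: D_def)
  also have "\<dots> \<le> D\<^sup>2 * (e J - e 0)"
    using pos J by (intro mult_left_mono) (auto simp: e_def)
  also have "\<dots> \<le> S D"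
    unfolding S using pos \<pi>_pos \<open>0 \<le> D\<close> \<open>x 0 \<le> x J\<close>
    by (auto intro!: add_nonneg_nonneg sum_nonneg mult_nonneg_nonneg simp: less_imp_le)
  finally have "m\<^sup>2 + \<sigma>\<^sup>2 \<le> S D" .
  moreover have "S 0 \<le> m\<^sup>2 + \<sigma>\<^sup>2"
    unfolding S using second by simp
  moreover have "continuous_on {0..D} S"
    unfolding S by (intro continuous_intros)
  ultimately obtain d where d: "0 \<le> d" "S d = m\<^sup>2 + \<sigma>\<^sup>2"
    using IVT'[of S 0 "m\<^sup>2 + \<sigma>\<^sup>2" D] \<open>0 \<le> D\<close> by auto
  have "0 \<le> e j" if "j \<in> {1..J}" for j
    using that pos by (auto simp: e_def)
  moreover have "e 0 \<le> 0"
    using pos J by (auto simp: e_def)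
  moreover have "e j \<le> e (j + 1)" if "j < J" for j
    using that pos J by (auto simp: e_def intro: order_trans[of _ 0])
  ultimately have "y d j \<le> y d (j + 1)" if "j < J" for j
    using mono[OF that] d(1) that by (auto simp: y_def intro!: add_mono mult_left_mono)
  then have "program_feasible J \<pi> \<sigma> m (y d)"
    using mean_y d(2) by (auto simp: program_feasible_def S_def)
  moreover have "x j \<le> y d j" if "j \<in> {1..J}" for j
    using \<open>\<And>j. j \<in> {1..J} \<Longrightarrow> 0 \<le> e j\<close>[OF that] d(1) by (simp add: y_def)
  ultimately show thesis
    by (rule that)
qed

lemma program_feasible_exists:
  assumes "(\<Sum>j=0..J. \<pi> j) = 1"
  shows "\<exists>y. program_feasible J \<pi> \<sigma> m y"
proof -
  have "(\<Sum>j=0..J. \<pi> j * C) = C" for C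
    using assms by (simp add: sum_distrib_right[symmetric])
  then show ?thesis
    using program_feasible_dominating[of "\<lambda>_. m" m \<sigma>] by (metis le_add_same_cancel1 order_refl zero_le_power2)
qed

lemma program_feasible_bounded:
  assumes "program_feasible J \<pi> \<sigma> m x" "j \<le> J"
  shows "\<bar>x j\<bar> \<le> (\<Sum>i=0..J. sqrt ((m\<^sup>2 + \<sigma>\<^sup>2) / \<pi> i))"
proof -
  have "\<pi> j * (x j)\<^sup>2 \<le> (\<Sum>i=0..J. \<pi> i * (x i)\<^sup>2)"
    using \<pi>_pos assms(2) by (intro member_le_sum) (auto simp: less_imp_le)
  then have "(x j)\<^sup>2 \<le> (m\<^sup>2 + \<sigma>\<^sup>2) / \<pi> j"
    using assms \<pi>_pos[of j] by (simp add: program_feasible_def field_simps)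
  then have "\<bar>x j\<bar> \<le> sqrt ((m\<^sup>2 + \<sigma>\<^sup>2) / \<pi> j)"
    using real_le_rsqrt[of "\<bar>x j\<bar>"] by simp
  also have "\<dots> \<le> (\<Sum>i=0..J. sqrt ((m\<^sup>2 + \<sigma>\<^sup>2) / \<pi> i))"
    using \<pi>_pos assms(2)
    by (intro member_le_sum[where f = "\<lambda>i. sqrt ((m\<^sup>2 + \<sigma>\<^sup>2) / \<pi> i)"]) (auto simp: less_imp_le)
  finally show ?thesis .
qed

text \<open>The second moment bounds all levels, because all masses are positive. Once the values beyond
  \<open>J\<close> are set to \<open>0\<close>, the feasible vectors form a compact set in the product topology.\<close>

lemma program_has_solution:
  assumes U: "continuous_on UNIV U" and feasible: "program_feasible J \<pi> \<sigma> m x"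
  shows "\<exists>y. solves_program U J \<omega> \<pi> \<sigma> m y"
proof -
  define B where "B = (\<Sum>i=0..J. sqrt ((m\<^sup>2 + \<sigma>\<^sup>2) / \<pi> i))"
  define F where "F = {y. program_feasible J \<pi> \<sigma> m y}"
  define box where "box = PiE UNIV (\<lambda>_::nat. {- B..B})"
  define trunc where "trunc y j = (if j \<le> J then y j else 0)" for y :: "nat \<Rightarrow> real" and j
  have "0 \<le> B"
    using program_feasible_bounded[OF feasible, of 0] unfolding B_def by linarith
  have trunc: "trunc y \<in> box \<inter> F" if "program_feasible J \<pi> \<sigma> m y" for y
  proof -
    have "program_feasible J \<pi> \<sigma> m (trunc y)"
      using that by (simp add: program_feasible_def trunc_def)
    moreover have "trunc y j \<in> {- B..B}" for j
      using program_feasible_bounded[OF that, of j] \<open>0 \<le> B\<close> by (auto simp: trunc_def B_def)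
    ultimately show ?thesis
      by (auto simp: box_def F_def)
  qed
  have cont: "continuous_on UNIV (\<lambda>y::nat \<Rightarrow> real. y j)" for j
    by (rule continuous_on_product_coordinates)
  have "compact box"
    unfolding box_def compactin_euclidean_iff[symmetric] euclidean_product_topology[symmetric]
    by (simp add: compactin_PiE)
  moreover have "closed F"
    unfolding F_def program_feasible_def
    by (intro closed_Collect_conj closed_Collect_all closed_Collect_imp closed_Collect_le
        closed_Collect_eq open_Collect_const continuous_intros cont)
  ultimately have "compact (box \<inter> F)"
    by (rule compact_Int_closed)
  moreover have "continuous_on (box \<inter> F) (program_value U J \<omega>)"
    unfolding program_value_def[abs_def]
    by (intro continuous_intros continuous_on_compose2[OF U] continuous_on_subset[OF cont]) auto
  ultimately obtain y where y: "y \<in> box \<inter> F"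
    "\<And>z. z \<in> box \<inter> F \<Longrightarrow> program_value U J \<omega> z \<le> program_value U J \<omega> y"
    using continuous_attains_sup[of "box \<inter> F" "program_value U J \<omega>"] trunc[OF feasible] by blast
  have "program_value U J \<omega> z \<le> program_value U J \<omega> y" if "program_feasible J \<pi> \<sigma> m z" for z
    using y(2)[OF trunc[OF that]] by (simp add: program_value_def trunc_def)
  then show ?thesis
    using y(1) by (auto simp: solves_program_def F_def)
qed

end

section \<open>Reducing quantile functions and loads to levels\<close>

locale percentile_grid =
  fixes J :: nat and p :: "nat \<Rightarrow> real"
  assumes J: "J \<ge> 1"
    and p_first: "0 < p 1"
    and p_incr: "\<And>j. j \<in> {1..<J} \<Longrightarrow> p j < p (j + 1)"
    and p_last: "p J < 1"
begin

abbreviation "\<pi> \<equiv> breakpoint_mass J p"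

text \<open>The endpoints \<open>0 < p 1 < \<dots> < p J < 1\<close> of the pieces, numbered so that the breakpoint masses are
  their successive differences.\<close>

definition cut :: "nat \<Rightarrow> real" where
  "cut j = (if j = 0 then 0 else if j \<le> J then p j else 1)"

text \<open>The point \<open>0\<close> is left out so that the pieces partition the open unit interval, the domain of the
  quantile functions.\<close>

definition piece :: "nat \<Rightarrow> real set" where
  "piece j = {cut j..<cut (Suc j)} - {0}"

lemma cut_less: "j \<le> J \<Longrightarrow> cut j < cut (Suc j)"
  using J p_first p_last p_incr[of j] by (cases "j = J") (auto simp: cut_def)

lemma cut_0: "cut 0 = 0" and cut_end: "cut (Suc J) = 1" and cut_p: "j \<in> {1..J} \<Longrightarrow> cut j = p j"
  by (auto simp: cut_def)

lemma cut_le: "i \<le> j \<Longrightarrow> j \<le> Suc J \<Longrightarrow> cut i \<le> cut j"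
proof (induction j rule: dec_induct)
  case (step n)
  then show ?case
    using cut_less[of n] by simp
qed simp

lemma mass_eq: "j \<le> J \<Longrightarrow> \<pi> j = cut (Suc j) - cut j"
  using J by (auto simp: cut_def breakpoint_mass_def next_percentile_def)

sublocale positive_weights J \<pi>
  by standard (use J mass_eq cut_less in auto)

lemma sum_mass: "(\<Sum>j=0..J. \<pi> j) = 1"
proof -
  have "(\<Sum>j=0..J. \<pi> j) = (\<Sum>j<Suc J. cut (Suc j) - cut j)"
    by (intro sum.cong) (auto simp: mass_eq)
  also have "\<dots> = 1"
    unfolding sum_lessThan_telescope cut_0 cut_end by simp
  finally show ?thesis .
qed

lemma pieces_partition: "(\<Sum>j=0..J. indicator (piece j) u) = (indicator {0<..<1} u :: real)"
proof -
  have "(\<Sum>j<n. indicator {cut j..<cut (Suc j)} u) = (indicator {0..<cut n} u :: real)"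
    if "n \<le> Suc J" for n
    using that
  proof (induction n)
    case (Suc n)
    have "cut 0 \<le> cut n" "cut n < cut (Suc n)"
      using Suc.prems by (auto intro: cut_le cut_less)
    then show ?case
      using Suc by (auto simp: cut_0 indicator_def)
  qed (simp add: cut_0)
  from this[of "Suc J"] show ?thesis
    unfolding piece_def atLeast0AtMost lessThan_Suc_atMost[symmetric]
    by (cases "u = 0") (auto simp: indicator_def cut_end)
qed

lemma piece_sets [measurable, simp]: "piece j \<in> sets borel"
  by (simp add: piece_def)

lemma piece_subset: "j \<le> J \<Longrightarrow> piece j \<subseteq> {0<..<1}"
  using cut_le[of 0 j] cut_le[of "Suc j" "Suc J"] by (auto simp: piece_def cut_0 cut_end)

lemma emeasure_piece: "j \<le> J \<Longrightarrow> emeasure lborel (piece j) = ennreal (\<pi> j)"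
  unfolding piece_def using cut_less[of j]
  by (subst emeasure_Diff_null_set) (auto simp: mass_eq)

lemma set_integrable_piece_const: "j \<le> J \<Longrightarrow> set_integrable lborel (piece j) (\<lambda>_. C :: real)"
  by (auto simp: set_integrable_def emeasure_piece intro!: integrable_mult_right integrable_real_indicator)

lemma set_integral_piece_const:
  "j \<le> J \<Longrightarrow> (LINT u:piece j|lborel. (C :: real)) = C * \<pi> j"
  using \<pi>_pos[of j] by (simp add: set_lebesgue_integral_def measure_def emeasure_piece)

lemma set_integral_pieces:
  fixes f :: "real \<Rightarrow> real"
  assumes f: "set_integrable lborel {0<..<1} f"
  shows "(LINT u:{0<..<1}|lborel. f u) = (\<Sum>j=0..J. LINT u:piece j|lborel. f u)"
proof -
  have "(LINT u:{0<..<1}|lborel. f u) = (LINT u|lborel. (\<Sum>j=0..J. indicator (piece j) u * f u))"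
    unfolding set_lebesgue_integral_def sum_distrib_right[symmetric] pieces_partition by simp
  also have "\<dots> = (\<Sum>j=0..J. LINT u|lborel. indicator (piece j) u * f u)"
  proof (rule Bochner_Integration.integral_sum)
    fix j assume "j \<in> {0..J}"
    then have "set_integrable lborel (piece j) f"
      using f piece_subset[of j] by (intro set_integrable_subset[OF f]) auto
    then show "integrable lborel (\<lambda>u. indicator (piece j) u * f u)"
      by (simp add: set_integrable_def)
  qed
  finally show ?thesis
    by (simp add: set_lebesgue_integral_def)
qed

text \<open>Monotonicity provides measurability, and \<open>\<bar>q\<bar> \<le> 1 + q\<^sup>2\<close> on an interval of finite length.\<close>

lemma square_set_integrable_imp:
  fixes q :: "real \<Rightarrow> real"
  assumes mono: "mono_on {0<..<1} q" and sq: "set_integrable lborel {0<..<1} (\<lambda>u. (q u)\<^sup>2)"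
  shows "set_integrable lborel {0<..<1} q"
proof -
  have "q \<in> borel_measurable (restrict_space borel {0<..<1})"
    using mono by (rule borel_measurable_mono_on_fnc)
  then have meas: "(\<lambda>u. indicator {0<..<1} u *\<^sub>R q u) \<in> borel_measurable lborel"
    by (subst (asm) borel_measurable_restrict_space_iff) auto
  have "set_integrable lborel {0<..<1} (\<lambda>u. 1 + (q u)\<^sup>2)"
    by (intro set_integral_add(1) sq) (simp add: set_integrable_def)
  then show ?thesis
    unfolding set_integrable_def
  proof (rule Bochner_Integration.integrable_bound)
    have "\<bar>x\<bar> \<le> 1 + x\<^sup>2" for x :: real
      using sum_squares_ge_zero[of "\<bar>x\<bar> - 1" "\<bar>x\<bar>"] zero_le_power2[of "\<bar>x\<bar> - 1"]
      by (simp add: power2_eq_square algebra_simps)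
    then show "AE u in lborel. norm (indicator {0<..<1} u *\<^sub>R q u)
        \<le> norm (indicator {0<..<1} u *\<^sub>R (1 + (q u)\<^sup>2))"
      by (auto simp: indicator_def)
  qed (rule meas)
qed

text \<open>The averages of \<open>q\<close> over the pieces are ordered, have the mean of \<open>q\<close> and, by Jensen's inequality,
  at most its second moment; they dominate \<open>v\<close> and are in turn dominated by a feasible vector. The
  numbers \<open>v j\<close> stand for the value of \<open>q\<close> at \<open>p j\<close>, or for the upper quantile of a law whose lower
  quantile function is \<open>q\<close>.\<close>

lemma program_feasible_above_quantile:
  assumes q: "mono_on {0<..<1} q" and sq: "set_integrable lborel {0<..<1} (\<lambda>u. (q u)\<^sup>2)"
    and mean: "(LINT u:{0<..<1}|lborel. q u) = m"
    and second: "(LINT u:{0<..<1}|lborel. (q u)\<^sup>2) = m\<^sup>2 + \<sigma>\<^sup>2"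
    and v: "\<And>j u. j \<in> {1..J} \<Longrightarrow> u \<in> {p j<..<1} \<Longrightarrow> v j \<le> q u"
  obtains y where "program_feasible J \<pi> \<sigma> m y" "\<And>j. j \<in> {1..J} \<Longrightarrow> v j \<le> y j"
proof -
  note int = square_set_integrable_imp[OF q sq]
  define x where "x j = (LINT u:piece j|lborel. q u) / \<pi> j" for j
  have int_q: "set_integrable lborel (piece j) q"
    and int_sq: "set_integrable lborel (piece j) (\<lambda>u. (q u)\<^sup>2)" if "j \<le> J" for j
    using piece_subset[OF that] by (auto intro: set_integrable_subset[OF int] set_integrable_subset[OF sq])
  have avg: "(LINT u:piece j|lborel. q u) = x j * \<pi> j" if "j \<le> J" for j
    using \<pi>_pos[OF that] by (simp add: x_def)
  have avg_le: "x j \<le> C" if "j \<le> J" "\<And>u. u \<in> piece j \<Longrightarrow> q u \<le> C" for j C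
  proof -
    have "x j * \<pi> j \<le> C * \<pi> j"
      unfolding avg[OF that(1), symmetric] set_integral_piece_const[OF that(1), of C, symmetric]
      using that by (intro set_integral_mono int_q set_integrable_piece_const)
    then show ?thesis
      using \<pi>_pos[OF that(1)] by simp
  qed
  have avg_ge: "C \<le> x j" if "j \<le> J" "\<And>u. u \<in> piece j - {cut j} \<Longrightarrow> C \<le> q u" for j C
  proof -
    have "C * \<pi> j \<le> x j * \<pi> j"
      unfolding avg[OF that(1), symmetric] set_integral_piece_const[OF that(1), of C, symmetric]
    proof (intro set_integral_mono_AE int_q set_integrable_piece_const that(1))
      show "AE u\<in>piece j in lborel. C \<le> q u"
        using AE_lborel_singleton[of "cut j"] by eventually_elim (use that(2) in auto)
    qed
    then show ?thesis
      using \<pi>_pos[OF that(1)] by simp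
  qed
  have "x j \<le> x (j + 1)" if j: "j < J" for j
  proof -
    have cut: "cut (Suc j) \<in> {0<..<1}"
      using cut_le[of 0 j] cut_less[of j] cut_less[of "Suc j"] cut_le[of "Suc (Suc j)" "Suc J"] j
      by (auto simp: cut_0 cut_end)
    have "x j \<le> q (cut (Suc j))"
      using j piece_subset[of j] cut
      by (intro avg_le) (auto intro!: mono_onD[OF q] simp: piece_def)
    also have "\<dots> \<le> x (Suc j)"
      using j piece_subset[of "Suc j"] cut
      by (intro avg_ge) (auto intro!: mono_onD[OF q] simp: piece_def)
    finally show ?thesis by simp
  qed
  moreover have "(\<Sum>j=0..J. \<pi> j * x j) = m"
    using mean set_integral_pieces[OF int] avg by (simp add: mult.commute)
  moreover have "(\<Sum>j=0..J. \<pi> j * (x j)\<^sup>2) \<le> m\<^sup>2 + \<sigma>\<^sup>2"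
  proof -
    have "\<pi> j * (x j)\<^sup>2 \<le> (LINT u:piece j|lborel. (q u)\<^sup>2)" if j: "j \<le> J" for j
    proof -
      \<comment> \<open>Jensen's inequality on one piece, from \<open>(q u - x j)\<^sup>2 \<ge> 0\<close>\<close>
      have "\<pi> j * (x j)\<^sup>2 = (LINT u:piece j|lborel. 2 * x j * q u - (x j)\<^sup>2)"
        using int_q[OF j] set_integrable_piece_const[OF j]
        by (subst set_integral_diff)
          (auto simp: avg[OF j] set_integral_piece_const[OF j] power2_eq_square)
      also have "\<dots> \<le> (LINT u:piece j|lborel. (q u)\<^sup>2)"
      proof (intro set_integral_mono set_integral_diff int_sq j set_integrable_piece_const
          set_integrable_mult_right int_q)
        show "2 * x j * q u - (x j)\<^sup>2 \<le> (q u)\<^sup>2" for u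
          using zero_le_power2[of "q u - x j"] by (simp add: power2_eq_square algebra_simps)
      qed
      finally show ?thesis .
    qed
    then have "(\<Sum>j=0..J. \<pi> j * (x j)\<^sup>2) \<le> (\<Sum>j=0..J. LINT u:piece j|lborel. (q u)\<^sup>2)"
      by (intro sum_mono) auto
    then show ?thesis
      using second set_integral_pieces[OF sq] by simp
  qed
  ultimately obtain y where y: "program_feasible J \<pi> \<sigma> m y" "\<And>j. j \<in> {1..J} \<Longrightarrow> x j \<le> y j"
    using program_feasible_dominating[of x m \<sigma>] by metis
  have "v j \<le> x j" if j: "j \<in> {1..J}" for j
    using j piece_subset[of j] by (intro avg_ge v) (auto simp: piece_def cut_p)
  then show thesis
    using y by (intro that[of y]) (auto intro: order_trans)
qed

lemma quantile_le_right:
  assumes "mono_on {0<..<1} q" "j \<in> {1..J}" "u \<in> {p j<..<1}"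
  shows "q (p j) \<le> q u"
proof -
  have "0 < p j"
    using cut_less[of 0] cut_le[of 1 j] assms(2) by (auto simp: cut_0 cut_p)
  then show ?thesis
    using assms by (auto intro: mono_onD)
qed

end

lemma ambiguity_set_moments:
  assumes M: "M \<in> ambiguity_set \<mu> s2"
  shows "integrable M (\<lambda>x. x - d)" "(LINT x|M. x - d) = \<mu> - d"
    and "integrable M (\<lambda>x. (x - d)\<^sup>2)" "(LINT x|M. (x - d)\<^sup>2) = (\<mu> - d)\<^sup>2 + s2"
proof -
  interpret real_distribution M
    using M by (simp add: ambiguity_set_def)
  have UNIV: "prob UNIV = 1"
    using prob_space by simp
  have int: "integrable M (\<lambda>x. x)" "integrable M (\<lambda>x. x\<^sup>2)"
    and mom: "(LINT x|M. x) = \<mu>" "(LINT x|M. (x - \<mu>)\<^sup>2) = s2"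
    using M by (auto simp: ambiguity_set_def)
  have sq: "integrable M (\<lambda>x. (x - e)\<^sup>2)" for e
    unfolding power2_diff
    by (intro Bochner_Integration.integrable_diff Bochner_Integration.integrable_add int
        integrable_mult_left integrable_mult_right) simp
  show "integrable M (\<lambda>x. x - d)" "integrable M (\<lambda>x. (x - d)\<^sup>2)"
    by (intro Bochner_Integration.integrable_diff int sq integrable_const)+
  show "(LINT x|M. x - d) = \<mu> - d"
    using int mom(1) by (simp add: UNIV)
  have "(LINT x|M. (x - d)\<^sup>2) =
      (LINT x|M. (x - \<mu>)\<^sup>2 + (2 * (\<mu> - d) * x - (\<mu>\<^sup>2 - d\<^sup>2)))"
    by (intro Bochner_Integration.integral_cong) (auto simp: power2_eq_square algebra_simps)
  also have "\<dots> = s2 + (2 * (\<mu> - d) * \<mu> - (\<mu>\<^sup>2 - d\<^sup>2))"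
    using int(1) mom sq[of \<mu>] by (simp add: UNIV)
  finally show "(LINT x|M. (x - d)\<^sup>2) = (\<mu> - d)\<^sup>2 + s2"
    by (simp add: power2_eq_square algebra_simps)
qed

lemma prob_space_unit_interval: "prob_space (restrict_space lborel {0<..<1::real})"
  by (auto simp: emeasure_restrict_space space_restrict_space intro!: prob_spaceI)

text \<open>\<open>I\<close> is the lower quantile function. At \<open>r\<close> it may lie strictly below the upper one, but every
  later lower quantile is past the jump.\<close>

lemma (in cdf_distribution) upper_quantile_le_I:
  assumes "0 < r" "r < u" "u < 1"
  shows "upper_quantile M r \<le> I u"
  unfolding upper_quantile_def
proof (rule cInf_lower)
  have "u \<le> C (I u)"
    using pseudoinverse[of u "I u"] assms by simp
  then show "I u \<in> {x. r < C x}"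
    using assms by simp
  show "bdd_below {x. r < C x}"
  proof (rule bdd_belowI[of _ "I r"])
    fix x assume "x \<in> {x. r < C x}"
    then show "I r \<le> x"
      using pseudoinverse[of r x] assms by simp
  qed
qed

lemma (in cdf_distribution) set_integral_I:
  fixes f :: "real \<Rightarrow> real"
  assumes [measurable]: "f \<in> borel_measurable borel"
  shows "set_integrable lborel {0<..<1} (\<lambda>u. f (I u)) \<longleftrightarrow> integrable M f"
    and "(LINT u:{0<..<1}|lborel. f (I u)) = (LINT x|M. f x)"
proof -
  let ?\<Omega> = "restrict_space lborel {0<..<1::real}"
  have [measurable]: "I \<in> borel_measurable ?\<Omega>"
    using measurable_CI measurable_cong_sets[OF sets_restrict_space_cong[OF sets_lborel] refl]
    by blast
  have "integrable M f \<longleftrightarrow> integrable ?\<Omega> (\<lambda>u. f (I u))"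
    by (subst distr_I_eq_M[symmetric], subst integrable_distr_eq) auto
  then show "set_integrable lborel {0<..<1} (\<lambda>u. f (I u)) \<longleftrightarrow> integrable M f"
    by (simp add: set_integrable_def integrable_restrict_space)
  have "(LINT x|M. f x) = (LINT u|?\<Omega>. f (I u))"
    by (subst distr_I_eq_M[symmetric], subst integral_distr) auto
  then show "(LINT u:{0<..<1}|lborel. f (I u)) = (LINT x|M. f x)"
    by (simp add: set_lebesgue_integral_def integral_restrict_space)
qed

text \<open>The lower quantile function carries the uniform distribution on the unit interval to \<open>M\<close>, so its
  integrals are the moments of \<open>M\<close>.\<close>

lemma (in percentile_grid) program_feasible_above_load:
  assumes M: "M \<in> ambiguity_set \<mu> (\<sigma>\<^sup>2)"
  obtains y where "program_feasible J \<pi> \<sigma> (\<mu> - d) y"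
    "\<And>j. j \<in> {1..J} \<Longrightarrow> upper_quantile M (p j) - d \<le> y j"
proof -
  interpret M: cdf_distribution M
    using M by (simp add: ambiguity_set_def cdf_distribution_def)
  note mom = ambiguity_set_moments[OF M, of d]
  have pos: "0 < p j" if "j \<in> {1..J}" for j
    using cut_less[of 0] cut_le[of 1 j] that by (auto simp: cut_0 cut_p)
  show thesis
  proof (rule program_feasible_above_quantile)
    show "mono_on {0<..<1} (\<lambda>u. M.I u - d)"
      using M.mono_I by (auto simp: mono_on_def)
    show "set_integrable lborel {0<..<1} (\<lambda>u. (M.I u - d)\<^sup>2)"
      using mom M.set_integral_I(1)[of "\<lambda>x. (x - d)\<^sup>2"] by simp
    show "(LINT u:{0<..<1}|lborel. M.I u - d) = \<mu> - d"
      using mom M.set_integral_I(2)[of "\<lambda>x. x - d"] by simp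
    show "(LINT u:{0<..<1}|lborel. (M.I u - d)\<^sup>2) = (\<mu> - d)\<^sup>2 + \<sigma>\<^sup>2"
      using mom M.set_integral_I(2)[of "\<lambda>x. (x - d)\<^sup>2"] by simp
    show "upper_quantile M (p j) - d \<le> M.I u - d" if "j \<in> {1..J}" "u \<in> {p j<..<1}" for j u
      using M.upper_quantile_le_I[of "p j" u] pos[OF that(1)] that(2) by simp
  qed (rule that)
qed

section \<open>Attainment by staircases\<close>

context percentile_grid
begin

text \<open>The number of percentiles that \<open>u\<close> has passed is the index of the piece containing \<open>u\<close>.\<close>

definition staircase :: "(nat \<Rightarrow> real) \<Rightarrow> real \<Rightarrow> real" where
  "staircase x u = x (card {i \<in> {1..J}. p i \<le> u})"

definition staircase_law :: "(nat \<Rightarrow> real) \<Rightarrow> real \<Rightarrow> real measure" where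
  "staircase_law x d = distr (restrict_space lborel {0<..<1}) borel (\<lambda>u. staircase x u + d)"

lemma staircase_eq:
  assumes "j \<le> J" "u \<in> {cut j..<cut (Suc j)}"
  shows "staircase x u = x j"
proof -
  have "p i \<le> u \<longleftrightarrow> i \<le> j" if "i \<in> {1..J}" for i
    using cut_le[of i j] cut_le[of "Suc j" i] cut_p[OF that] that assms
    by (cases "i \<le> j") (auto simp: not_less_eq_eq)
  then have "{i \<in> {1..J}. p i \<le> u} = {1..j}"
    using assms by auto
  then show ?thesis
    by (simp add: staircase_def)
qed

lemma staircase_mono_on:
  assumes x: "program_feasible J \<pi> \<sigma> m x"
  shows "mono_on A (staircase x)"
proof (rule mono_onI)
  fix u v :: real assume "u \<le> v"
  then have "card {i \<in> {1..J}. p i \<le> u} \<le> card {i \<in> {1..J}. p i \<le> v}"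
    by (intro card_mono) auto
  moreover have "card {i \<in> {1..J}. p i \<le> v} \<le> card {1..J}"
    by (intro card_mono) auto
  ultimately show "staircase x u \<le> staircase x v"
    unfolding staircase_def by (intro program_feasible_mono[OF x]) auto
qed

lemma staircase_integral:
  shows "set_integrable lborel {0<..<1} (\<lambda>u. f (staircase x u) :: real)"
    and "(LINT u:{0<..<1}|lborel. f (staircase x u)) = (\<Sum>j=0..J. \<pi> j * f (x j))"
proof -
  have eq: "indicator {0<..<1} u *\<^sub>R f (staircase x u) =
      (\<Sum>j=0..J. indicator (piece j) u *\<^sub>R f (x j))" for u
    unfolding pieces_partition[symmetric] scaleR_sum_left
    by (intro sum.cong refl) (auto simp: indicator_def piece_def staircase_eq)
  have int: "integrable lborel (\<lambda>u. indicator (piece j) u *\<^sub>R f (x j))" if "j \<in> {0..J}" for j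
    using set_integrable_piece_const[of j "f (x j)"] that by (simp add: set_integrable_def)
  show "set_integrable lborel {0<..<1} (\<lambda>u. f (staircase x u))"
    unfolding set_integrable_def eq by (intro Bochner_Integration.integrable_sum int)
  have "(LINT u:{0<..<1}|lborel. f (staircase x u)) =
      (\<Sum>j=0..J. LINT u:piece j|lborel. f (x j))"
    unfolding set_lebesgue_integral_def eq by (intro Bochner_Integration.integral_sum int)
  also have "\<dots> = (\<Sum>j=0..J. \<pi> j * f (x j))"
    by (intro sum.cong refl) (simp add: set_integral_piece_const mult.commute)
  finally show "(LINT u:{0<..<1}|lborel. f (staircase x u)) = (\<Sum>j=0..J. \<pi> j * f (x j))" .
qed

lemma staircase_in_quantile_cone:
  assumes x: "program_feasible J \<pi> \<sigma> m x"
  shows "staircase x \<in> quantile_cone J p"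
  unfolding quantile_cone_def
proof (intro CollectI conjI ballI staircase_mono_on[OF x] staircase_integral)
  fix j assume j: "j \<in> {1..J}"
  have "\<forall>\<^sub>F u in at_right (p j). u < cut (Suc j)"
    using cut_less[of j] cut_p[OF j] j by (intro order_tendstoD(2)[OF tendsto_ident_at]) auto
  then have "\<forall>\<^sub>F u in at_right (p j). staircase x u = staircase x (p j)"
    using eventually_at_right_less[of "p j"]
    by eventually_elim (use cut_p[OF j] j staircase_eq[of j _ x] in auto)
  then show "continuous (at_right (p j)) (staircase x)"
    by (simp add: continuous_within tendsto_eventually)
qed

lemma staircase_measurable:
  assumes x: "program_feasible J \<pi> \<sigma> m x"
  shows "(\<lambda>u. staircase x u + d) \<in> borel_measurable (restrict_space lborel {0<..<1})"
proof -
  have "(\<lambda>u. staircase x u + d) \<in> borel_measurable (restrict_space borel {0<..<1})"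
    using staircase_mono_on[OF x] by (intro borel_measurable_mono_on_fnc) (auto simp: mono_on_def)
  then show ?thesis
    using measurable_cong_sets[OF sets_restrict_space_cong[OF sets_lborel] refl] by blast
qed

lemma staircase_law_real_distribution:
  assumes x: "program_feasible J \<pi> \<sigma> m x"
  shows "real_distribution (staircase_law x d)"
proof -
  interpret prob_space "restrict_space lborel {0<..<1::real}"
    by (rule prob_space_unit_interval)
  show ?thesis
    unfolding staircase_law_def using staircase_measurable[OF x] by (rule real_distribution_distr)
qed

lemma staircase_law_shift:
  assumes x: "program_feasible J \<pi> \<sigma> m x"
  shows "distr (staircase_law x d) borel (\<lambda>y. y - d) = staircase_law x 0"
proof -
  have "(\<lambda>y::real. y - d) \<in> borel_measurable borel"
    by measurable
  from distr_distr[OF this staircase_measurable[OF x, of d]] show ?thesis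
    by (simp add: staircase_law_def comp_def)
qed

lemma staircase_law_integral:
  assumes x: "program_feasible J \<pi> \<sigma> m x" and f: "f \<in> borel_measurable borel"
  shows "integrable (staircase_law x d) (f :: real \<Rightarrow> real)"
    and "(LINT y|staircase_law x d. f y) = (\<Sum>j=0..J. \<pi> j * f (x j + d))"
proof -
  note meas = staircase_measurable[OF x, of d]
  show "integrable (staircase_law x d) f"
    unfolding staircase_law_def integrable_distr_eq[OF meas f]
    using staircase_integral(1)[of "\<lambda>y. f (y + d)" x]
    by (simp add: integrable_restrict_space set_integrable_def)
  have "(LINT y|staircase_law x d. f y) = (LINT u:{0<..<1}|lborel. f (staircase x u + d))"
    unfolding staircase_law_def integral_distr[OF meas f]
    by (simp add: integral_restrict_space set_lebesgue_integral_def)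
  then show "(LINT y|staircase_law x d. f y) = (\<Sum>j=0..J. \<pi> j * f (x j + d))"
    using staircase_integral(2)[of "\<lambda>y. f (y + d)" x] by simp
qed

lemma staircase_law_in_ambiguity_set:
  assumes x: "program_feasible J \<pi> \<sigma> (\<mu> - d) x"
  shows "staircase_law x d \<in> ambiguity_set \<mu> (\<sigma>\<^sup>2)"
proof -
  have mean: "(\<Sum>j=0..J. \<pi> j * x j) = \<mu> - d"
    and second: "(\<Sum>j=0..J. \<pi> j * (x j)\<^sup>2) = (\<mu> - d)\<^sup>2 + \<sigma>\<^sup>2"
    using x by (auto simp: program_feasible_def)
  have "(\<Sum>j=0..J. \<pi> j * (x j + d)) = (\<Sum>j=0..J. \<pi> j * x j) + d * (\<Sum>j=0..J. \<pi> j)"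
    unfolding sum_distrib_left sum.distrib[symmetric] by (intro sum.cong) (auto simp: algebra_simps)
  then have 1: "(\<Sum>j=0..J. \<pi> j * (x j + d)) = \<mu>"
    by (simp add: mean sum_mass)
  have "(\<Sum>j=0..J. \<pi> j * (x j + d - \<mu>)\<^sup>2) = (\<Sum>j=0..J. \<pi> j * (x j)\<^sup>2)
      - 2 * (\<mu> - d) * (\<Sum>j=0..J. \<pi> j * x j) + (\<mu> - d)\<^sup>2 * (\<Sum>j=0..J. \<pi> j)"
    unfolding sum_distrib_left sum.distrib[symmetric] sum_subtractf[symmetric]
    by (intro sum.cong) (auto simp: algebra_simps power2_eq_square)
  then have 2: "(\<Sum>j=0..J. \<pi> j * (x j + d - \<mu>)\<^sup>2) = \<sigma>\<^sup>2"
    unfolding mean second sum_mass by (simp add: power2_eq_square algebra_simps)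
  show ?thesis
    unfolding ambiguity_set_def
  proof (intro CollectI conjI)
    show "(LINT y|staircase_law x d. y) = \<mu>"
      by (rule trans[OF staircase_law_integral(2)[OF x] 1]) simp
    show "(LINT y|staircase_law x d. (y - \<mu>)\<^sup>2) = \<sigma>\<^sup>2"
      by (rule trans[OF staircase_law_integral(2)[OF x] 2]) simp
  qed (rule staircase_law_real_distribution[OF x] staircase_law_integral(1)[OF x]; simp)+
qed

text \<open>The distribution function exceeds \<open>u\<close> exactly from the level of its piece on: the set where the
  staircase is at most \<open>y\<close> contains \<open>(0, cut (j + 1))\<close> if \<open>y\<close> has reached this level, and is contained
  in \<open>(0, cut j)\<close> otherwise.\<close>

lemma upper_quantile_staircase_law:
  assumes x: "program_feasible J \<pi> \<sigma> m x" and j: "j \<le> J" and u: "u \<in> {cut j..<cut (Suc j)}"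
  shows "upper_quantile (staircase_law x d) u = x j + d"
proof -
  let ?\<Omega> = "restrict_space lborel {0<..<1::real}"
  interpret prob_space ?\<Omega>
    by (rule prob_space_unit_interval)
  note meas = staircase_measurable[OF x, of d]
  have prob_eq: "measure ?\<Omega> {0<..<t} = t" if "0 \<le> t" "t \<le> 1" for t :: real
    using that by (subst measure_restrict_space) auto
  have sub: "measure ?\<Omega> A \<le> measure ?\<Omega> B" if "A \<subseteq> B" "B \<in> sets ?\<Omega>" for A B
    using that by (intro finite_measure_mono) auto
  have Iio_sets: "{0<..<t} \<in> sets ?\<Omega>" if "t \<le> 1" for t
    using that by (auto simp: sets_restrict_space_iff)
  have cut_bounds: "0 \<le> cut j" "cut (Suc j) \<le> 1"
    using cut_le[of 0 j] cut_le[of "Suc j" "Suc J"] j by (auto simp: cut_0 cut_end)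
  have level_set_eq: "{v \<in> {0<..<1}. staircase x v + d \<le> y} =
      (\<lambda>v. staircase x v + d) -` {..y} \<inter> space ?\<Omega>" for y
    by (auto simp: space_restrict_space)
  have level_sets: "{v \<in> {0<..<1}. staircase x v + d \<le> y} \<in> sets ?\<Omega>" for y
    unfolding level_set_eq by (rule measurable_sets[OF meas]) simp
  have cdf: "cdf (staircase_law x d) y =
      measure ?\<Omega> {v \<in> {0<..<1}. staircase x v + d \<le> y}" for y
    unfolding cdf_def staircase_law_def level_set_eq by (rule measure_distr[OF meas]) simp
  have mono: "staircase x v \<le> staircase x w" if "v \<le> w" for v w
    using staircase_mono_on[OF x, of UNIV] that by (auto intro: mono_onD)
  have "u < cdf (staircase_law x d) y \<longleftrightarrow> x j + d \<le> y" for y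
  proof
    assume y: "x j + d \<le> y"
    have "{0<..<cut (Suc j)} \<subseteq> {v \<in> {0<..<1}. staircase x v + d \<le> y}"
    proof
      fix v assume v: "v \<in> {0<..<cut (Suc j)}"
      have "staircase x v \<le> staircase x (max u v)"
        by (rule mono) simp
      also have "\<dots> = x j"
        using u v by (intro staircase_eq j) auto
      finally show "v \<in> {v \<in> {0<..<1}. staircase x v + d \<le> y}"
        using v y cut_bounds by auto
    qed
    then have "measure ?\<Omega> {0<..<cut (Suc j)} \<le> cdf (staircase_law x d) y"
      unfolding cdf by (rule sub[OF _ level_sets])
    then have "cut (Suc j) \<le> cdf (staircase_law x d) y"
      using prob_eq[of "cut (Suc j)"] cut_bounds u by simp
    then show "u < cdf (staircase_law x d) y"
      using u by auto
  next
    assume less: "u < cdf (staircase_law x d) y"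
    show "x j + d \<le> y"
    proof (rule ccontr)
      assume y: "\<not> x j + d \<le> y"
      have "{v \<in> {0<..<1}. staircase x v + d \<le> y} \<subseteq> {0<..<cut j}"
      proof
        fix v assume v: "v \<in> {v \<in> {0<..<1}. staircase x v + d \<le> y}"
        have "\<not> cut j \<le> v"
        proof
          assume "cut j \<le> v"
          then have "staircase x (cut j) \<le> staircase x v"
            by (rule mono)
          moreover have "staircase x (cut j) = x j"
            using cut_less[OF j] by (intro staircase_eq j) auto
          ultimately show False
            using v y by auto
        qed
        then show "v \<in> {0<..<cut j}"
          using v by auto
      qed
      moreover have "cut j \<le> 1"
        using cut_bounds cut_less[OF j] by simp
      ultimately have "cdf (staircase_law x d) y \<le> measure ?\<Omega> {0<..<cut j}"
        unfolding cdf by (intro sub Iio_sets)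
      then have "cdf (staircase_law x d) y \<le> cut j"
        using prob_eq[of "cut j"] cut_bounds cut_less[OF j] by simp
      then show False
        using less u by auto
    qed
  qed
  then have "{y. u < cdf (staircase_law x d) y} = {x j + d..}"
    by auto
  then show ?thesis
    unfolding upper_quantile_def by simp
qed

lemma program_value_mono:
  assumes U: "\<And>s t. s \<le> t \<Longrightarrow> U s \<le> U t" and \<omega>: "\<And>j. j \<in> {1..J} \<Longrightarrow> 0 < \<omega> j"
    and le: "\<And>j. j \<in> {1..J} \<Longrightarrow> v j \<le> y j"
  shows "program_value U J \<omega> v \<le> program_value U J \<omega> y"
  unfolding program_value_def
  using assms by (intro sum_mono mult_left_mono) (auto simp: less_imp_le)

text \<open>The staircase of \<open>x\<close> attains the value, and every competitor is dominated by a feasible vector.\<close>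

lemma reduced_credit_eq_program_value:
  assumes U: "\<And>s t. s \<le> t \<Longrightarrow> U s \<le> U t" and \<omega>: "\<And>j. j \<in> {1..J} \<Longrightarrow> 0 < \<omega> j"
    and x: "solves_program U J \<omega> \<pi> \<sigma> m x"
  shows "reduced_credit U J p \<omega> \<sigma> m = program_value U J \<omega> x"
  unfolding reduced_credit_def
proof (rule cSup_eq_maximum)
  have feasible: "program_feasible J \<pi> \<sigma> m x"
    using x by (simp add: solves_program_def)
  have "staircase x (p j) = x j" if "j \<in> {1..J}" for j
    using that cut_less[of j] cut_p[OF that] by (intro staircase_eq) auto
  then have attained: "(\<Sum>j=1..J. \<omega> j * U (staircase x (p j))) = program_value U J \<omega> x"
    by (simp add: program_value_def)
  show "program_value U J \<omega> x \<in> {\<Sum>j = 1..J. \<omega> j * U (q (p j)) |q. q \<in> quantile_cone J p \<and>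
      (LINT u:{0<..<1}|lborel. q u) = m \<and> (LINT u:{0<..<1}|lborel. (q u)\<^sup>2) = m\<^sup>2 + \<sigma>\<^sup>2}"
    using staircase_in_quantile_cone[OF feasible] staircase_integral(2)[of "\<lambda>y. y" x]
      staircase_integral(2)[of "\<lambda>y. y\<^sup>2" x] feasible attained
    by (intro CollectI exI[of _ "staircase x"]) (auto simp: program_feasible_def)
next
  fix z assume "z \<in> {\<Sum>j = 1..J. \<omega> j * U (q (p j)) |q. q \<in> quantile_cone J p \<and>
      (LINT u:{0<..<1}|lborel. q u) = m \<and> (LINT u:{0<..<1}|lborel. (q u)\<^sup>2) = m\<^sup>2 + \<sigma>\<^sup>2}"
  then obtain q where z: "z = program_value U J \<omega> (\<lambda>j. q (p j))"
    and q: "mono_on {0<..<1} q" "set_integrable lborel {0<..<1} (\<lambda>u. (q u)\<^sup>2)"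
      "(LINT u:{0<..<1}|lborel. q u) = m" "(LINT u:{0<..<1}|lborel. (q u)\<^sup>2) = m\<^sup>2 + \<sigma>\<^sup>2"
    by (auto simp: quantile_cone_def program_value_def)
  obtain y where y: "program_feasible J \<pi> \<sigma> m y" "\<And>j. j \<in> {1..J} \<Longrightarrow> q (p j) \<le> y j"
    using program_feasible_above_quantile[OF q, of "\<lambda>j. q (p j)"] quantile_le_right[OF q(1)]
    by metis
  have "z \<le> program_value U J \<omega> y"
    unfolding z by (intro program_value_mono U \<omega> y)
  also have "\<dots> \<le> program_value U J \<omega> x"
    using x y(1) by (simp add: solves_program_def)
  finally show "z \<le> program_value U J \<omega> x" .
qed

lemma liability_staircase_law:
  assumes x: "program_feasible J \<pi> \<sigma> m x"
  shows "liability U J p \<omega> \<eta> c (staircase_law x (\<eta> * c)) = program_value U J \<omega> x"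
  unfolding liability_def program_value_def
proof (intro sum.cong refl)
  fix j assume j: "j \<in> {1..J}"
  then have "upper_quantile (staircase_law x (\<eta> * c)) (p j) = x j + \<eta> * c"
    using cut_less[of j] cut_p[OF j] by (intro upper_quantile_staircase_law[OF x]) auto
  then show "\<omega> j * U (upper_quantile (staircase_law x (\<eta> * c)) (p j) - \<eta> * c) = \<omega> j * U (x j)"
    by simp
qed

text \<open>The law of the staircase, shifted back to load coordinates, attains the value; every competing
  load is dominated by a feasible vector.\<close>

lemma worst_liability_eq_program_value:
  assumes U: "\<And>s t. s \<le> t \<Longrightarrow> U s \<le> U t" and \<omega>: "\<And>j. j \<in> {1..J} \<Longrightarrow> 0 < \<omega> j"
    and x: "solves_program U J \<omega> \<pi> \<sigma> (\<mu> - \<eta> * c) x"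
  shows "worst_liability U J p \<omega> \<mu> \<sigma> \<eta> c = program_value U J \<omega> x"
  unfolding worst_liability_def
proof (rule cSup_eq_maximum)
  have feasible: "program_feasible J \<pi> \<sigma> (\<mu> - \<eta> * c) x"
    using x by (simp add: solves_program_def)
  show "program_value U J \<omega> x \<in> liability U J p \<omega> \<eta> c ` ambiguity_set \<mu> (\<sigma>\<^sup>2)"
    using staircase_law_in_ambiguity_set[OF feasible]
    by (intro image_eqI[of _ _ "staircase_law x (\<eta> * c)"] liability_staircase_law[OF feasible, symmetric])
next
  fix z assume "z \<in> liability U J p \<omega> \<eta> c ` ambiguity_set \<mu> (\<sigma>\<^sup>2)"
  then obtain M where M: "M \<in> ambiguity_set \<mu> (\<sigma>\<^sup>2)"
    and z: "z = program_value U J \<omega> (\<lambda>j. upper_quantile M (p j) - \<eta> * c)"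
    by (auto simp: liability_def program_value_def)
  obtain y where y: "program_feasible J \<pi> \<sigma> (\<mu> - \<eta> * c) y"
    "\<And>j. j \<in> {1..J} \<Longrightarrow> upper_quantile M (p j) - \<eta> * c \<le> y j"
    using program_feasible_above_load[OF M] by metis
  have "z \<le> program_value U J \<omega> y"
    unfolding z by (intro program_value_mono U \<omega> y)
  also have "\<dots> \<le> program_value U J \<omega> x"
    using x y(1) by (simp add: solves_program_def)
  finally show "z \<le> program_value U J \<omega> x" .
qed

end

section \<open>A lemma of Farkas\<close>

text \<open>Linearity, in the only combination that the elimination step below uses.\<close>

definition linear_form :: "(('k \<Rightarrow> real) \<Rightarrow> real) \<Rightarrow> bool" where
  "linear_form f \<longleftrightarrow> (\<forall>x y t. f (\<lambda>k. x k + t * y k) = f x + t * f y)"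

lemma linear_formD: "linear_form f \<Longrightarrow> f (\<lambda>k. x k + t * y k) = f x + t * f y"
  by (simp add: linear_form_def)

lemma linear_form_zero: "linear_form f \<Longrightarrow> f (\<lambda>_. 0) = 0"
  using linear_formD[of f "\<lambda>_. 0" 1 "\<lambda>_. 0"] by simp

text \<open>The rows in \<open>P\<close> are inequalities, the others equations. If removing a row \<open>e\<close> destroys the
  implication, then some \<open>z\<close> satisfies all other rows while \<open>g z > 0\<close>, and \<open>f e z\<close> cannot vanish.
  Projecting along \<open>z\<close> onto the kernel of \<open>f e\<close> eliminates the row, the other multipliers come from
  the induction hypothesis, and the multiplier of \<open>e\<close> is read off at \<open>z\<close>, where its sign is visible.\<close>

lemma farkas:
  fixes f :: "'i \<Rightarrow> ('k \<Rightarrow> real) \<Rightarrow> real"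
  assumes "finite I" "\<And>i. i \<in> I \<Longrightarrow> linear_form (f i)" "linear_form g"
    and "\<And>x. (\<And>i. i \<in> I \<Longrightarrow> f i x \<le> 0) \<Longrightarrow> (\<And>i. i \<in> I - P \<Longrightarrow> f i x = 0) \<Longrightarrow> g x \<le> 0"
  shows "\<exists>y. (\<forall>i\<in>I \<inter> P. 0 \<le> y i) \<and> (\<forall>x. g x = (\<Sum>i\<in>I. y i * f i x))"
  using assms
proof (induction I arbitrary: f g rule: finite_induct)
  case empty
  have "g x = 0" for x
  proof -
    have "g (\<lambda>k. - x k) = - g x"
      using linear_formD[OF empty.prems(2), of "\<lambda>_. 0" "- 1" x]
        linear_form_zero[OF empty.prems(2)] by simp
    then show ?thesis
      using empty.prems(3)[of x] empty.prems(3)[of "\<lambda>k. - x k"] by simp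
  qed
  then show ?case
    by simp
next
  case (insert e I)
  note f = insert.prems(1) and g = insert.prems(2) and cone = insert.prems(3)
  show ?case
  proof (cases "\<forall>x. (\<forall>i\<in>I. f i x \<le> 0) \<longrightarrow> (\<forall>i\<in>I - P. f i x = 0) \<longrightarrow> g x \<le> 0")
    case True
    then obtain y where y: "\<forall>i\<in>I \<inter> P. 0 \<le> y i" "\<forall>x. g x = (\<Sum>i\<in>I. y i * f i x)"
      using insert.IH[of f g] f g by auto
    have "(\<Sum>i\<in>I. (y(e := 0)) i * f i x) = (\<Sum>i\<in>I. y i * f i x)" for x
      using insert.hyps by (intro sum.cong) auto
    then show ?thesis
      using y insert.hyps by (intro exI[of _ "y(e := 0)"]) auto
  next
    case False
    then obtain z where z: "\<And>i. i \<in> I \<Longrightarrow> f i z \<le> 0" "\<And>i. i \<in> I - P \<Longrightarrow> f i z = 0" "0 < g z"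
      by (auto simp: not_le)
    have fz: "f e z \<noteq> 0" "e \<in> P \<Longrightarrow> 0 < f e z"
      using cone[of z] z by force+
    \<comment> \<open>the projection along \<open>z\<close> onto the kernel of \<open>f e\<close>\<close>
    define proj where "proj x k = x k + (- f e x / f e z) * z k" for x k
    have proj: "h (proj x) = h x + (- f e x / f e z) * h z" if "linear_form h" for h x
      unfolding proj_def[abs_def] by (rule linear_formD[OF that])
    have lin: "linear_form (\<lambda>x. h (proj x))" if h: "linear_form h" for h
      using h f[of e] unfolding proj[OF h]
      by (auto simp: linear_form_def algebra_simps add_divide_distrib)
    have "f e (proj x) = 0" for x
      using proj[of "f e" x] f[of e] fz(1) by simp
    then have "g (proj x) \<le> 0"
      if "\<And>i. i \<in> I \<Longrightarrow> f i (proj x) \<le> 0" "\<And>i. i \<in> I - P \<Longrightarrow> f i (proj x) = 0" for x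
      using that by (intro cone) auto
    then obtain y where y: "\<forall>i\<in>I \<inter> P. 0 \<le> y i"
      "\<forall>x. g (proj x) = (\<Sum>i\<in>I. y i * f i (proj x))"
      using insert.IH[of "\<lambda>i x. f i (proj x)" "\<lambda>x. g (proj x)"] lin f g by auto
    define r where "r = (g z - (\<Sum>i\<in>I. y i * f i z)) / f e z"
    have "(\<Sum>i\<in>I. y i * f i z) \<le> 0"
    proof (rule sum_nonpos)
      fix i assume "i \<in> I"
      then show "y i * f i z \<le> 0"
        using z(1,2)[of i] y(1) by (cases "i \<in> P") (auto intro: mult_nonneg_nonpos)
    qed
    then have "0 \<le> r" if "e \<in> P"
      using fz(2)[OF that] z(3) by (simp add: r_def)
    moreover have "g x = r * f e x + (\<Sum>i\<in>I. y i * f i x)" for x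
    proof -
      have "g x - f e x / f e z * g z = (\<Sum>i\<in>I. y i * (f i x - f e x / f e z * f i z))"
        using y(2) proj[OF g, of x] proj[OF f, of _ x] by simp
      also have "\<dots> = (\<Sum>i\<in>I. y i * f i x) - f e x / f e z * (\<Sum>i\<in>I. y i * f i z)"
        unfolding sum_distrib_left sum_subtractf[symmetric]
        by (intro sum.cong) (auto simp: algebra_simps)
      finally show ?thesis
        by (simp add: r_def diff_divide_distrib algebra_simps)
    qed
    moreover have "(\<Sum>i\<in>I. (y(e := r)) i * f i x) = (\<Sum>i\<in>I. y i * f i x)" for x
      using insert.hyps by (intro sum.cong) auto
    ultimately show ?thesis
      using y(1) insert.hyps by (intro exI[of _ "y(e := r)"]) auto
  qed
qed

section \<open>First-order conditions for the program\<close>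

text \<open>The direction \<open>d\<close> preserves the mean, the second moment to first order, and the order of tied
  levels. The vector \<open>x + t d\<close> has mean \<open>m\<close> and variance \<open>\<sigma>\<^sup>2 + t\<^sup>2 (\<Sum>j=0..J. \<pi> j * (d j)\<^sup>2)\<close>,
  so contracting it towards \<open>m\<close> by a suitable factor \<open>s t\<close> restores the variance exactly; as \<open>s\<close> has derivative \<open>0\<close> at \<open>0\<close>, the resulting
  feasible curve still leaves \<open>x\<close> with velocity \<open>d\<close>. The minimum of the two slopes times \<open>d j\<close> is a
  lower bound for the directional derivative at a concave or convex kink.\<close>

lemma program_first_order:
  assumes solves: "solves_program U J \<omega> \<pi> \<sigma> m x" and \<sigma>: "0 < \<sigma>"
    and mass: "(\<Sum>j=0..J. \<pi> j) = 1" and \<pi>: "\<And>j. j \<le> J \<Longrightarrow> 0 < \<pi> j"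
    and \<omega>: "\<And>j. j \<in> {1..J} \<Longrightarrow> 0 < \<omega> j"
    and kink: "\<And>j. j \<in> {1..J} \<Longrightarrow> kink U (x j) (l j) (r j)"
    and mean: "(\<Sum>j=0..J. \<pi> j * d j) = 0" and spread: "(\<Sum>j=0..J. \<pi> j * x j * d j) = 0"
    and order: "\<And>j. j < J \<Longrightarrow> x (j + 1) = x j \<Longrightarrow> d j \<le> d (j + 1)"
  shows "(\<Sum>j=1..J. \<omega> j * min (l j * d j) (r j * d j)) \<le> 0"
proof -
  have x: "\<And>j. j < J \<Longrightarrow> x j \<le> x (j + 1)" "(\<Sum>j=0..J. \<pi> j * x j) = m"
    "(\<Sum>j=0..J. \<pi> j * (x j)\<^sup>2) = m\<^sup>2 + \<sigma>\<^sup>2"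
    using solves by (auto simp: solves_program_def program_feasible_def)
  define D where "D = (\<Sum>j=0..J. \<pi> j * (d j)\<^sup>2)"
  have "0 \<le> D"
    unfolding D_def using \<pi> by (intro sum_nonneg) (auto simp: less_imp_le)
  define s where "s t = \<sigma> / sqrt (\<sigma>\<^sup>2 + t\<^sup>2 * D)" for t
  have root: "0 < \<sigma>\<^sup>2 + t\<^sup>2 * D" for t
    using \<sigma> \<open>0 \<le> D\<close> by (intro add_pos_nonneg) auto
  \<comment> \<open>the displacement from \<open>x\<close> of the feasible curve at time \<open>t\<close>\<close>
  define h where "h t j = (s t - 1) * (x j - m) + s t * t * d j" for t j
  have deriv: "(s has_real_derivative 0) (at 0)"
    unfolding s_def[abs_def] using root[of 0] \<sigma> by (auto intro!: derivative_eq_intros)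
  have quotient: "((\<lambda>t. (s t - 1) / t) \<longlongrightarrow> 0) (at_right 0)"
  proof -
    have "((\<lambda>t. (s t - s 0) / (t - 0)) \<longlongrightarrow> 0) (at_right 0)"
      using deriv unfolding has_field_derivative_iff
      by (rule filterlim_mono[OF _ order_refl at_le]) simp
    then show ?thesis
      using \<sigma> by (simp add: s_def)
  qed
  have s_lim: "(s \<longlongrightarrow> 1) (at_right 0)"
  proof -
    have "(s \<longlongrightarrow> \<sigma> / sqrt (\<sigma>\<^sup>2 + 0\<^sup>2 * D)) (at_right 0)"
      unfolding s_def[abs_def] using root[of 0] by (intro tendsto_intros) auto
    then show ?thesis
      using \<sigma> by simp
  qed
  have dir: "((\<lambda>t. h t j / t) \<longlongrightarrow> d j) (at_right 0)" for j
  proof -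
    have "((\<lambda>t. (s t - 1) / t * (x j - m) + s t * d j) \<longlongrightarrow> 0 * (x j - m) + 1 * d j) (at_right 0)"
      by (intro tendsto_intros quotient s_lim)
    moreover have "\<forall>\<^sub>F t in at_right 0. (s t - 1) / t * (x j - m) + s t * d j = h t j / t"
      using eventually_at_right_less[of 0] by eventually_elim (simp add: h_def add_divide_distrib)
    ultimately show ?thesis
      by (auto elim: Lim_transform_eventually)
  qed
  have small: "((\<lambda>t. h t j) \<longlongrightarrow> 0) (at_right 0)" for j
  proof -
    have "((\<lambda>t. (s t - 1) * (x j - m) + s t * t * d j) \<longlongrightarrow> (1 - 1) * (x j - m) + 1 * 0 * d j)
        (at_right 0)"
      by (intro tendsto_intros s_lim)
    then show ?thesis
      by (simp add: h_def)
  qed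
  have order_ev: "\<forall>\<^sub>F t in at_right 0. \<forall>j<J. x j + t * d j \<le> x (j + 1) + t * d (j + 1)"
  proof -
    have "\<forall>\<^sub>F t in at_right 0. x j + t * d j \<le> x (j + 1) + t * d (j + 1)" if j: "j < J" for j
    proof (cases "x (j + 1) = x j")
      case True
      show ?thesis
        using eventually_at_right_less[of 0]
        by eventually_elim (use True order[OF j True] in simp)
    next
      case False
      have "((\<lambda>t. x j + t * d j - (x (j + 1) + t * d (j + 1))) \<longlongrightarrow>
          x j + 0 * d j - (x (j + 1) + 0 * d (j + 1))) (at_right 0)"
        by (intro tendsto_intros)
      then have "\<forall>\<^sub>F t in at_right 0. x j + t * d j - (x (j + 1) + t * d (j + 1)) < 0"
        using False x(1)[OF j] by (intro order_tendstoD(2)) auto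
      then show ?thesis
        by eventually_elim auto
    qed
    then have "\<forall>\<^sub>F t in at_right 0. \<forall>j\<in>{..<J}. x j + t * d j \<le> x (j + 1) + t * d (j + 1)"
      by (intro eventually_ball_finite) auto
    then show ?thesis
      by (rule eventually_mono) auto
  qed
  have kink_ev: "\<forall>\<^sub>F t in at_right 0. \<forall>j\<in>{1..J}.
      U (x j + h t j) = U (x j) + (if 0 \<le> h t j then r j else l j) * h t j"
    using kink small unfolding kink_def
    by (intro eventually_ball_finite ballI eventually_compose_filterlim[OF _ small]) auto
  have "\<forall>\<^sub>F t in at_right 0. (\<Sum>j=1..J. \<omega> j * min (l j * (h t j / t)) (r j * (h t j / t))) \<le> 0"
    using eventually_at_right_less[of 0] order_ev kink_ev
  proof eventually_elim
    case (elim t)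
    define y where "y j = x j + t * d j - m" for j
    have y1: "(\<Sum>j=0..J. \<pi> j * y j) = 0"
    proof -
      have "(\<Sum>j=0..J. \<pi> j * y j) =
          (\<Sum>j=0..J. \<pi> j * x j) + t * (\<Sum>j=0..J. \<pi> j * d j) - m * (\<Sum>j=0..J. \<pi> j)"
        unfolding y_def sum_distrib_left sum.distrib[symmetric] sum_subtractf[symmetric]
        by (intro sum.cong) (auto simp: algebra_simps)
      then show ?thesis
        by (simp add: x(2) mean mass)
    qed
    have y2: "(\<Sum>j=0..J. \<pi> j * (y j)\<^sup>2) = \<sigma>\<^sup>2 + t\<^sup>2 * D"
    proof -
      have "(\<Sum>j=0..J. \<pi> j * (y j)\<^sup>2) =
          (\<Sum>j=0..J. \<pi> j * (x j)\<^sup>2) + t\<^sup>2 * D + m\<^sup>2 * (\<Sum>j=0..J. \<pi> j)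
          + 2 * t * (\<Sum>j=0..J. \<pi> j * x j * d j)
          - 2 * m * (\<Sum>j=0..J. \<pi> j * x j) - 2 * m * t * (\<Sum>j=0..J. \<pi> j * d j)"
        unfolding y_def D_def sum_distrib_left sum.distrib[symmetric] sum_subtractf[symmetric]
        by (intro sum.cong) (auto simp: power2_eq_square algebra_simps)
      also have "\<dots> = \<sigma>\<^sup>2 + t\<^sup>2 * D"
        unfolding x(2,3) mean spread mass by (simp add: power2_eq_square)
      finally show ?thesis .
    qed
    have "0 \<le> s t"
      using \<sigma> root[of t] by (simp add: s_def)
    have s2: "(s t)\<^sup>2 * (\<sigma>\<^sup>2 + t\<^sup>2 * D) = \<sigma>\<^sup>2"
      using root[of t] by (simp add: s_def power_divide)
    have eq: "x j + h t j = m + s t * y j" for j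
      by (simp add: h_def y_def algebra_simps)
    have "program_feasible J \<pi> \<sigma> m (\<lambda>j. x j + h t j)"
      unfolding program_feasible_def eq
    proof (intro conjI allI impI)
      show "m + s t * y j \<le> m + s t * y (j + 1)" if "j < J" for j
        using elim(2) that \<open>0 \<le> s t\<close> by (auto simp: y_def intro!: mult_left_mono)
      have "(\<Sum>j=0..J. \<pi> j * (m + s t * y j)) = m * (\<Sum>j=0..J. \<pi> j) + s t * (\<Sum>j=0..J. \<pi> j * y j)"
        unfolding sum_distrib_left sum.distrib[symmetric]
        by (intro sum.cong) (auto simp: algebra_simps)
      then show "(\<Sum>j=0..J. \<pi> j * (m + s t * y j)) = m"
        by (simp add: mass y1)
      have "(\<Sum>j=0..J. \<pi> j * (m + s t * y j)\<^sup>2) = m\<^sup>2 * (\<Sum>j=0..J. \<pi> j)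
          + 2 * m * s t * (\<Sum>j=0..J. \<pi> j * y j) + (s t)\<^sup>2 * (\<Sum>j=0..J. \<pi> j * (y j)\<^sup>2)"
        unfolding sum_distrib_left sum.distrib[symmetric]
        by (intro sum.cong) (auto simp: power2_eq_square algebra_simps)
      then show "(\<Sum>j=0..J. \<pi> j * (m + s t * y j)\<^sup>2) = m\<^sup>2 + \<sigma>\<^sup>2"
        by (simp only: mass y1 y2 s2)
    qed
    then have opt: "program_value U J \<omega> (\<lambda>j. x j + h t j) \<le> program_value U J \<omega> x"
      using solves by (simp add: solves_program_def)
    have "(\<Sum>j=1..J. \<omega> j * (t * min (l j * (h t j / t)) (r j * (h t j / t))))
        \<le> (\<Sum>j=1..J. \<omega> j * (U (x j + h t j) - U (x j)))"
    proof (intro sum_mono mult_left_mono)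
      fix j assume j: "j \<in> {1..J}"
      have "t * min (l j * (h t j / t)) (r j * (h t j / t)) = min (l j * h t j) (r j * h t j)"
        using elim(1) by (simp add: min_mult_distrib_left)
      also have "\<dots> \<le> (if 0 \<le> h t j then r j else l j) * h t j"
        by auto
      also have "\<dots> = U (x j + h t j) - U (x j)"
        using elim(3) j by auto
      finally show "t * min (l j * (h t j / t)) (r j * (h t j / t)) \<le> U (x j + h t j) - U (x j)" .
    qed (use \<omega> in \<open>auto simp: less_imp_le\<close>)
    also have "\<dots> \<le> 0"
      using opt by (simp add: program_value_def right_diff_distrib sum_subtractf)
    finally have "t * (\<Sum>j=1..J. \<omega> j * min (l j * (h t j / t)) (r j * (h t j / t))) \<le> 0"
      unfolding sum_distrib_left by (simp add: mult.left_commute)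
    then show ?case
      using elim(1) by (simp add: mult_le_0_iff)
  qed
  moreover have "((\<lambda>t. \<Sum>j=1..J. \<omega> j * min (l j * (h t j / t)) (r j * (h t j / t))) \<longlongrightarrow>
      (\<Sum>j=1..J. \<omega> j * min (l j * d j) (r j * d j))) (at_right 0)"
    by (intro tendsto_intros dir)
  ultimately show ?thesis
    by (intro tendsto_upperbound) auto
qed

text \<open>Rows of the linear system for the pair of a direction \<open>d\<close> and lower bounds \<open>t\<close>: \<open>Mean\<close> and \<open>Spread\<close>
  keep the two moments to first order, \<open>Order j\<close> keeps tied levels in order, and the two slope rows
  express \<open>t j \<le> min (l j * d j) (r j * d j)\<close>.\<close>

datatype constraint = Mean | Spread | LeftSlope nat | RightSlope nat | Order nat

lemma sum_unit_difference:
  fixes v :: "nat \<Rightarrow> real"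
  assumes "i \<le> J"
  shows "(\<Sum>j<J. v j * ((if j = i then 1 else 0) - (if Suc j = i then 1 else 0))) =
    (if i < J then v i else 0) - (if 1 \<le> i then v (i - 1) else 0)"
proof (cases i)
  case 0
  then show ?thesis
    by (simp add: if_distrib[of "(*) _"] cong: if_cong)
next
  case (Suc k)
  have "(\<Sum>j<J. v j * ((if j = i then 1 else 0) - (if Suc j = i then 1 else 0))) =
      (\<Sum>j<J. if j = i then v j else 0) - (\<Sum>j<J. if j = k then v j else 0)"
    unfolding sum_subtractf[symmetric] using Suc by (intro sum.cong) auto
  then show ?thesis
    using assms Suc by simp
qed

text \<open>Farkas' lemma is applied to the variables \<open>Inl j\<close> for \<open>d j\<close> and \<open>Inr j\<close> for \<open>t j\<close>. Comparing
  coefficients at \<open>Inr j\<close> shows that the multipliers of the two slope rows add up to \<open>\<omega> j\<close>, so they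
  mix the slopes into a point of the Clarke subdifferential; comparing coefficients at \<open>Inl j\<close> gives
  the stationarity equations. Complementary slackness is built in, since only ties have a row.\<close>

lemma program_multipliers_exist:
  assumes solves: "solves_program U J \<omega> \<pi> \<sigma> m x" and \<sigma>: "0 < \<sigma>"
    and mass: "(\<Sum>j=0..J. \<pi> j) = 1" and \<pi>: "\<And>j. j \<le> J \<Longrightarrow> 0 < \<pi> j"
    and \<omega>: "\<And>j. j \<in> {1..J} \<Longrightarrow> 0 < \<omega> j"
    and kink: "\<And>j. j \<in> {1..J} \<Longrightarrow> \<exists>l r. kink U (x j) l r"
  shows "\<exists>lam1 lam2 \<xi> \<nu>. program_multipliers U J \<omega> \<pi> x lam1 lam2 \<xi> \<nu>"
proof -
  from kink obtain l r where lr: "\<And>j. j \<in> {1..J} \<Longrightarrow> kink U (x j) (l j) (r j)"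
    by metis
  define f :: "constraint \<Rightarrow> (nat + nat \<Rightarrow> real) \<Rightarrow> real" where
    "f i z = (case i of
        Mean \<Rightarrow> (\<Sum>j=0..J. \<pi> j * z (Inl j))
      | Spread \<Rightarrow> (\<Sum>j=0..J. \<pi> j * x j * z (Inl j))
      | LeftSlope j \<Rightarrow> z (Inr j) - l j * z (Inl j)
      | RightSlope j \<Rightarrow> z (Inr j) - r j * z (Inl j)
      | Order j \<Rightarrow> z (Inl j) - z (Inl (Suc j)))" for i z
  define g :: "(nat + nat \<Rightarrow> real) \<Rightarrow> real" where "g z = (\<Sum>j=1..J. \<omega> j * z (Inr j))" for z
  define T where "T = {j. j < J \<and> x (Suc j) = x j}"
  define I where
    "I = insert Mean (insert Spread (LeftSlope ` {1..J} \<union> (RightSlope ` {1..J} \<union> Order ` T)))"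
  have "finite T"
    by (simp add: T_def)
  have lin_f: "linear_form (f i)" for i
    by (cases i)
      (simp_all add: linear_form_def f_def sum.distrib sum_distrib_left algebra_simps)
  have lin_g: "linear_form g"
    by (simp add: linear_form_def g_def sum.distrib sum_distrib_left algebra_simps)
  have cone: "g z \<le> 0" if neg: "\<And>i. i \<in> I \<Longrightarrow> f i z \<le> 0"
    and zero: "\<And>i. i \<in> I - (- {Mean, Spread}) \<Longrightarrow> f i z = 0" for z
  proof -
    have "g z \<le> (\<Sum>j=1..J. \<omega> j * min (l j * z (Inl j)) (r j * z (Inl j)))"
      unfolding g_def
    proof (intro sum_mono mult_left_mono)
      fix j assume "j \<in> {1..J}"
      then show "z (Inr j) \<le> min (l j * z (Inl j)) (r j * z (Inl j))"
        using neg[of "LeftSlope j"] neg[of "RightSlope j"] by (auto simp: I_def f_def)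
    qed (use \<omega> in \<open>auto simp: less_imp_le\<close>)
    also have "\<dots> \<le> 0"
    proof (rule program_first_order[OF solves \<sigma> mass \<pi> \<omega> lr])
      show "(\<Sum>j=0..J. \<pi> j * z (Inl j)) = 0" "(\<Sum>j=0..J. \<pi> j * x j * z (Inl j)) = 0"
        using zero[of Mean] zero[of Spread] by (simp_all add: I_def f_def)
      show "z (Inl j) \<le> z (Inl (j + 1))" if "j < J" "x (j + 1) = x j" for j
        using neg[of "Order j"] that by (simp add: I_def f_def T_def)
    qed
    finally show ?thesis .
  qed
  have "finite I"
    using \<open>finite T\<close> by (simp add: I_def)
  then have "\<exists>y. (\<forall>i\<in>I \<inter> - {Mean, Spread}. 0 \<le> y i) \<and> (\<forall>z. g z = (\<Sum>i\<in>I. y i * f i z))"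
    using lin_f lin_g cone by (rule farkas)
  then obtain y where y_nonneg: "\<forall>i\<in>I \<inter> - {Mean, Spread}. 0 \<le> y i"
    and y: "\<forall>z. g z = (\<Sum>i\<in>I. y i * f i z)"
    by (elim exE conjE)
  define \<alpha> where "\<alpha> j = y (LeftSlope j)" for j
  define \<beta> where "\<beta> j = y (RightSlope j)" for j
  define \<nu> where "\<nu> j = (if j \<in> T then y (Order j) else 0)" for j
  define \<xi> where "\<xi> j = (\<alpha> j * l j + \<beta> j * r j) / \<omega> j" for j
  have split: "sum h I = h Mean + h Spread + (\<Sum>j=1..J. h (LeftSlope j))
      + (\<Sum>j=1..J. h (RightSlope j)) + (\<Sum>j\<in>T. h (Order j))" for h :: "constraint \<Rightarrow> real"
  proof -
    have reindex: "sum h (c ` S) = (\<Sum>j\<in>S. h (c j))" if "inj c" for c :: "nat \<Rightarrow> constraint" and S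
      using that by (subst sum.reindex) (auto simp: inj_on_def)
    have "sum h (RightSlope ` {1..J} \<union> Order ` T) = (\<Sum>j=1..J. h (RightSlope j)) + (\<Sum>j\<in>T. h (Order j))"
      using \<open>finite T\<close> by (subst sum.union_disjoint) (auto simp: reindex inj_def)
    then have "sum h (LeftSlope ` {1..J} \<union> (RightSlope ` {1..J} \<union> Order ` T)) =
        (\<Sum>j=1..J. h (LeftSlope j)) + ((\<Sum>j=1..J. h (RightSlope j)) + (\<Sum>j\<in>T. h (Order j)))"
      using \<open>finite T\<close> by (subst sum.union_disjoint) (auto simp: reindex inj_def)
    moreover have "Mean \<notin> insert Spread (LeftSlope ` {1..J} \<union> (RightSlope ` {1..J} \<union> Order ` T))"
      "Spread \<notin> LeftSlope ` {1..J} \<union> (RightSlope ` {1..J} \<union> Order ` T)"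
      by auto
    ultimately show ?thesis
      using \<open>finite T\<close> by (simp add: I_def)
  qed
  have expand: "(\<Sum>j=1..J. \<omega> j * t j) = y Mean * (\<Sum>j=0..J. \<pi> j * d j)
      + y Spread * (\<Sum>j=0..J. \<pi> j * x j * d j)
      + (\<Sum>j=1..J. \<alpha> j * (t j - l j * d j)) + (\<Sum>j=1..J. \<beta> j * (t j - r j * d j))
      + (\<Sum>j<J. \<nu> j * (d j - d (Suc j)))" for t d
  proof -
    let ?z = "case_sum d t"
    have "(\<Sum>j\<in>T. y (Order j) * f (Order j) ?z) = (\<Sum>j\<in>T. \<nu> j * (d j - d (Suc j)))"
      by (intro sum.cong) (auto simp: f_def \<nu>_def)
    also have "\<dots> = (\<Sum>j<J. \<nu> j * (d j - d (Suc j)))"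
      by (intro sum.mono_neutral_left) (auto simp: T_def \<nu>_def)
    finally have order: "(\<Sum>j\<in>T. y (Order j) * f (Order j) ?z) = (\<Sum>j<J. \<nu> j * (d j - d (Suc j)))" .
    have "(\<Sum>j=1..J. \<omega> j * t j) = (\<Sum>i\<in>I. y i * f i ?z)"
      using y[rule_format, of ?z] by (simp add: g_def)
    then show ?thesis
      unfolding split order by (simp add: f_def \<alpha>_def \<beta>_def)
  qed
  have weights: "\<omega> i = \<alpha> i + \<beta> i" if "i \<in> {1..J}" for i
    using expand[of "\<lambda>j. if j = i then 1 else 0" "\<lambda>_. 0"] that
    by (simp add: if_distrib[of "(*) _"] cong: if_cong)
  have stationary: "0 = y Mean * \<pi> i + y Spread * (\<pi> i * x i)
      - (if 1 \<le> i then \<alpha> i * l i + \<beta> i * r i else 0)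
      + ((if i < J then \<nu> i else 0) - (if 1 \<le> i then \<nu> (i - 1) else 0))" if i: "i \<le> J" for i
  proof -
    have "(\<Sum>j=1..J. c j * (0 - s j * (if j = i then 1 else 0))) = - (if 1 \<le> i then c i * s i else 0)"
      for c s :: "nat \<Rightarrow> real"
      using i by (simp add: if_distrib[of "(*) _"] sum_negf cong: if_cong)
    moreover have "(\<Sum>j=0..J. c j * (if j = i then 1 else 0)) = c i" for c :: "nat \<Rightarrow> real"
      using i by (simp add: if_distrib[of "(*) _"] cong: if_cong)
    ultimately show ?thesis
      using expand[of "\<lambda>_. 0" "\<lambda>j. if j = i then 1 else 0"] i
      by (simp only: sum_unit_difference mult_zero_right sum.neutral_const) auto
  qed
  have slopes: "\<omega> i * \<xi> i = \<alpha> i * l i + \<beta> i * r i" if "i \<in> {1..J}" for i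
    using \<omega>[OF that] by (simp add: \<xi>_def)
  have \<nu>_last: "\<nu> J = 0"
    by (simp add: \<nu>_def T_def)
  \<comment> \<open>the row \<open>Spread\<close> carries \<open>x j\<close>, half the derivative of the square, hence the division by 2\<close>
  have "program_multipliers U J \<omega> \<pi> x (y Mean) (y Spread / 2) \<xi> \<nu>"
    unfolding program_multipliers_def
  proof (intro conjI ballI allI impI \<nu>_last)
    fix j assume j: "j \<in> {1..J}"
    have nonneg: "0 \<le> \<alpha> j" "0 \<le> \<beta> j"
      using y_nonneg[rule_format, of "LeftSlope j"] y_nonneg[rule_format, of "RightSlope j"] j
      by (auto simp: I_def \<alpha>_def \<beta>_def)
    then have "\<alpha> j * min (l j) (r j) + \<beta> j * min (l j) (r j) \<le> \<alpha> j * l j + \<beta> j * r j"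
      "\<alpha> j * l j + \<beta> j * r j \<le> \<alpha> j * max (l j) (r j) + \<beta> j * max (l j) (r j)"
      by (auto intro!: add_mono mult_left_mono)
    then have "\<omega> j * min (l j) (r j) \<le> \<omega> j * \<xi> j" "\<omega> j * \<xi> j \<le> \<omega> j * max (l j) (r j)"
      unfolding slopes[OF j] unfolding weights[OF j] distrib_right by simp_all
    then have "min (l j) (r j) \<le> \<xi> j" "\<xi> j \<le> max (l j) (r j)"
      using mult_le_cancel_left_pos[OF \<omega>[OF j]] by blast+
    then show "\<xi> j \<in> clarke_subdifferential U (x j)"
      by (rule kink_clarke_subdifferential[OF lr[OF j]])
    show "\<omega> j * \<xi> j = \<pi> j * (y Mean + 2 * (y Spread / 2) * x j) + (\<nu> j - \<nu> (j - 1))"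
      using stationary[of j] slopes[OF j] j \<nu>_last
      by (cases "j = J") (auto simp: algebra_simps)
  next
    show "0 = \<pi> 0 * (y Mean + 2 * (y Spread / 2) * x 0) + \<nu> 0"
      using stationary[of 0] \<nu>_last by (cases "J = 0") (auto simp: algebra_simps)
  next
    fix j assume "j < J"
    show "0 \<le> \<nu> j"
      using y_nonneg[rule_format, of "Order j"] by (auto simp: \<nu>_def I_def)
    show "\<nu> j * (x (j + 1) - x j) = 0"
      by (auto simp: \<nu>_def T_def)
  qed
  then show ?thesis
    by blast
qed

section \<open>Levels as an isotonic regression\<close>

text \<open>By the stationarity equations, the partial sums of the weighted residuals are \<open>\<nu> j / (2 * lam2)\<close>.
  Summation by parts and complementary slackness then yield the variational inequality.\<close>

lemma multipliers_isotonic_regression: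
  assumes mult: "program_multipliers U J \<omega> \<pi> x lam1 lam2 \<xi> \<nu>" and lam2: "0 < lam2"
    and \<pi>: "\<And>j. j \<le> J \<Longrightarrow> 0 < \<pi> j" and x: "mono_on {..<J + 1} x"
  shows "isotonic_regression (J + 1) \<pi> (level_candidate \<omega> \<pi> lam1 lam2 \<xi>) x"
proof (rule isotonic_regression_variational[OF x])
  let ?R = "level_candidate \<omega> \<pi> lam1 lam2 \<xi>"
  show "0 < \<pi> j" if "j < J + 1" for j
    using \<pi>[of j] that by simp
  fix y :: "nat \<Rightarrow> real" assume y: "mono_on {..<J + 1} y"
  define s where "s j = \<pi> j * (?R j - x j)" for j
  have prefix: "(\<Sum>i<Suc j. s i) = \<nu> j / (2 * lam2)" if "j \<le> J" for j
    using that
  proof (induction j)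
    case 0
    have "0 = \<pi> 0 * (lam1 + 2 * lam2 * x 0) + \<nu> 0"
      using mult by (simp add: program_multipliers_def)
    then show ?case
      using lam2 by (simp add: s_def level_candidate_def base_level_def field_simps)
  next
    case (Suc j)
    have "\<omega> (Suc j) * \<xi> (Suc j) =
        \<pi> (Suc j) * (lam1 + 2 * lam2 * x (Suc j)) + (\<nu> (Suc j) - \<nu> j)"
      using mult Suc.prems by (auto simp: program_multipliers_def)
    moreover have "2 * lam2 * s (Suc j) =
        \<omega> (Suc j) * \<xi> (Suc j) - \<pi> (Suc j) * (lam1 + 2 * lam2 * x (Suc j))"
      using lam2 \<pi>[OF Suc.prems] by (simp add: s_def level_candidate_def base_level_def field_simps)
    ultimately have "s (Suc j) = (\<nu> (Suc j) - \<nu> j) / (2 * lam2)"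
      using lam2 by (simp add: field_simps)
    then show ?case
      using Suc by (simp add: diff_divide_distrib)
  qed
  have "(\<Sum>j<Suc J. s j * (y j - x j)) =
      - (\<Sum>i<J. \<nu> i / (2 * lam2) * ((y (Suc i) - x (Suc i)) - (y i - x i)))"
  proof -
    have total: "(\<Sum>i<Suc J. s i) = 0"
      using prefix[of J] mult by (simp add: program_multipliers_def)
    show ?thesis
      unfolding summation_by_parts total by (simp add: prefix del: sum.lessThan_Suc)
  qed
  also have "\<dots> = - (\<Sum>i<J. \<nu> i / (2 * lam2) * (y (Suc i) - y i))"
  proof -
    have slack: "\<nu> i / (2 * lam2) * ((y (Suc i) - x (Suc i)) - (y i - x i)) =
        \<nu> i / (2 * lam2) * (y (Suc i) - y i)" if "i < J" for i
    proof -
      have "\<nu> i * (x (Suc i) - x i) = 0"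
        using mult that by (simp add: program_multipliers_def)
      then show ?thesis
        by auto
    qed
    show ?thesis
      by (intro arg_cong[where f = uminus] sum.cong) (simp_all only: lessThan_iff slack)
  qed
  also have "\<dots> \<le> 0"
    using mult lam2 mono_onD[OF y]
    by (auto simp: program_multipliers_def intro!: sum_nonneg mult_nonneg_nonneg)
  finally show "(\<Sum>j<J + 1. \<pi> j * (?R j - x j) * (y j - x j)) \<le> 0"
    by (simp add: s_def)
qed

text \<open>Complementary slackness removes the multipliers on both sides of an isolated level.\<close>

lemma isolated_level:
  assumes mult: "program_multipliers U J \<omega> \<pi> x lam1 lam2 \<xi> \<nu>" and lam2: "0 < lam2"
    and \<pi>: "0 < \<pi> j" and j: "j \<in> {1..J}"
    and isolated: "x j \<noteq> x (j - 1)" "j < J \<Longrightarrow> x j \<noteq> x (j + 1)"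
  shows "x j = base_level lam1 lam2 + \<omega> j * \<xi> j / (2 * lam2 * \<pi> j)"
proof -
  have "j - 1 < J" "j - 1 + 1 = j"
    using j by auto
  then have "\<nu> (j - 1) * (x j - x (j - 1)) = 0"
    using mult unfolding program_multipliers_def by metis
  then have "\<nu> (j - 1) = 0"
    using isolated(1) by simp
  moreover have "\<nu> j = 0"
  proof (cases "j = J")
    case False
    then have "\<nu> j * (x (j + 1) - x j) = 0" "j < J"
      using mult j by (simp_all add: program_multipliers_def)
    then show ?thesis
      using isolated(2) by simp
  qed (use mult in \<open>simp add: program_multipliers_def\<close>)
  ultimately have "\<omega> j * \<xi> j = \<pi> j * (lam1 + 2 * lam2 * x j)"
    using mult j by (auto simp: program_multipliers_def)
  then show ?thesis
    using lam2 \<pi> by (simp add: base_level_def field_simps)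
qed

lemma isolated_bulk_level:
  assumes mult: "program_multipliers U J \<omega> \<pi> x lam1 lam2 \<xi> \<nu>" and lam2: "0 < lam2"
    and \<pi>: "0 < \<pi> 0" and J: "1 \<le> J" and isolated: "x 0 < x 1"
  shows "x 0 = base_level lam1 lam2"
proof -
  have "\<nu> 0 * (x (0 + 1) - x 0) = 0" "0 = \<pi> 0 * (lam1 + 2 * lam2 * x 0) + \<nu> 0"
    using mult J by (auto simp: program_multipliers_def)
  then have "lam1 + 2 * lam2 * x 0 = 0"
    using isolated \<pi> by simp
  then show ?thesis
    using lam2 by (simp add: base_level_def field_simps)
qed

section \<open>Vanishing variance\<close>

lemma ambiguity_set_zero_variance: "ambiguity_set \<mu> 0 = {return borel \<mu>}"
proof (intro equalityI subsetI)
  fix M assume M: "M \<in> ambiguity_set \<mu> 0"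
  then interpret real_distribution M
    by (simp add: ambiguity_set_def)
  have "integrable M (\<lambda>x. (x - \<mu>)\<^sup>2)" "(LINT x|M. (x - \<mu>)\<^sup>2) = 0"
    using ambiguity_set_moments(3)[OF M] M by (auto simp: ambiguity_set_def)
  then have "AE x in M. (x - \<mu>)\<^sup>2 = 0"
    by (subst (asm) integral_nonneg_eq_0_iff_AE) auto
  then have "AE x in M. x = \<mu>"
    by eventually_elim simp
  then have "distr M borel (\<lambda>x. x) = distr M borel (\<lambda>_. \<mu>)"
    by (intro distr_cong_AE) auto
  moreover have "distr M borel (\<lambda>x. x) = M"
    by (intro distr_id2) simp
  moreover have "distr M borel (\<lambda>_. \<mu>) = return borel \<mu>"
    by (intro distr_const) simp
  ultimately show "M \<in> {return borel \<mu>}"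
    by simp
next
  let ?M = "return borel \<mu>"
  interpret prob_space ?M
    by (rule prob_space_return) simp
  have real: "real_distribution ?M"
    by standard simp_all
  have int: "integrable ?M f" if f: "f \<in> borel_measurable borel" for f :: "real \<Rightarrow> real"
  proof (rule integrable_const_bound[of _ "\<bar>f \<mu>\<bar>"])
    show "AE x in ?M. norm (f x) \<le> \<bar>f \<mu>\<bar>"
      using f by (subst AE_return) auto
    show "f \<in> borel_measurable ?M"
      using f by simp
  qed
  have exp: "(LINT x|?M. f x) = f \<mu>" if "f \<in> borel_measurable borel" for f :: "real \<Rightarrow> real"
    using that by (intro integral_return) auto
  have "?M \<in> ambiguity_set \<mu> 0"
    unfolding ambiguity_set_def by (intro CollectI conjI real int) (simp_all add: exp)
  then show "M \<in> ambiguity_set \<mu> 0" if "M \<in> {return borel \<mu>}" for M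
    using that by blast
qed

text \<open>A competitor equals \<open>m\<close> almost everywhere; being monotone, it is squeezed at \<open>p j\<close> between points
  on either side where it takes the value \<open>m\<close>.\<close>

lemma (in percentile_grid) reduced_credit_zero_variance:
  assumes \<omega>: "(\<Sum>j=1..J. \<omega> j) = 1"
  shows "reduced_credit U J p \<omega> 0 m = U m"
  unfolding reduced_credit_def
proof (rule cSup_eq_maximum)
  have const: "set_integrable lborel {0<..<1::real} (\<lambda>_. C)"
    "(LINT u:{0<..<1::real}|lborel. C) = C" for C :: real
    by (simp_all add: set_integrable_def set_lebesgue_integral_def measure_def)
  have total: "(\<Sum>j=1..J. \<omega> j * U m) = U m"
    using \<omega> by (simp add: sum_distrib_right[symmetric])
  show "U m \<in> {\<Sum>j = 1..J. \<omega> j * U (q (p j)) |q. q \<in> quantile_cone J p \<and>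
      (LINT u:{0<..<1}|lborel. q u) = m \<and> (LINT u:{0<..<1}|lborel. (q u)\<^sup>2) = m\<^sup>2 + 0\<^sup>2}"
    by (intro CollectI exI[of _ "\<lambda>_. m"] conjI total[symmetric])
      (simp_all add: const quantile_cone_def mono_on_def)
  fix z assume "z \<in> {\<Sum>j = 1..J. \<omega> j * U (q (p j)) |q. q \<in> quantile_cone J p \<and>
      (LINT u:{0<..<1}|lborel. q u) = m \<and> (LINT u:{0<..<1}|lborel. (q u)\<^sup>2) = m\<^sup>2 + 0\<^sup>2}"
  then obtain q where z: "z = (\<Sum>j = 1..J. \<omega> j * U (q (p j)))"
    and q: "mono_on {0<..<1} q" "set_integrable lborel {0<..<1} (\<lambda>u. (q u)\<^sup>2)"
      "(LINT u:{0<..<1}|lborel. q u) = m" "(LINT u:{0<..<1}|lborel. (q u)\<^sup>2) = m\<^sup>2"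
    by (auto simp: quantile_cone_def)
  note int = square_set_integrable_imp[OF q(1,2)]
  have sq_eq: "(\<lambda>u. (q u - m)\<^sup>2) = (\<lambda>u. (q u)\<^sup>2 - (2 * m * q u - m\<^sup>2))"
    by (auto simp: power2_eq_square algebra_simps)
  have lin: "set_integrable lborel {0<..<1} (\<lambda>u. 2 * m * q u - m\<^sup>2)"
    by (intro set_integral_diff(1) set_integrable_mult_right int const)
  have "set_integrable lborel {0<..<1} (\<lambda>u. (q u - m)\<^sup>2)"
    unfolding sq_eq by (rule set_integral_diff(1)[OF q(2) lin])
  moreover have "(LINT u:{0<..<1}|lborel. (q u - m)\<^sup>2) = 0"
    unfolding sq_eq set_integral_diff(2)[OF q(2) lin]
      set_integral_diff(2)[OF set_integrable_mult_right[OF int] const(1)]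
    by (simp only: q set_integral_mult_right const) (simp add: power2_eq_square)
  ultimately have "AE u in lborel. indicator {0<..<1} u *\<^sub>R (q u - m)\<^sup>2 = 0"
    unfolding set_integrable_def set_lebesgue_integral_def
    by (subst (asm) integral_nonneg_eq_0_iff_AE) auto
  then have ae: "AE u in lborel. u \<in> {0<..<1} \<longrightarrow> q u = m"
    by eventually_elim (auto simp: indicator_def)
  have ex: "\<exists>u\<in>{s<..<t}. q u = m" if "0 \<le> s" "s < t" "t \<le> 1" for s t
  proof (rule ccontr)
    assume none: "\<not> ?thesis"
    from ae have "AE u in lborel. u \<notin> {s<..<t}"
      by (rule eventually_mono) (use none that in auto)
    then have "emeasure lborel {s<..<t} = 0"
      using AE_iff_measurable[of "{s<..<t}" lborel "\<lambda>u. u \<notin> {s<..<t}"] by (auto simp: set_eq_iff)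
    with that show False
      by simp
  qed
  have "q (p j) = m" if j: "j \<in> {1..J}" for j
  proof -
    have pj: "0 < p j" "p j < 1"
      using cut_less[of 0] cut_le[of 1 j] cut_less[of j] cut_le[of "Suc j" "Suc J"] j
      by (auto simp: cut_0 cut_end cut_p)
    obtain u where u: "u \<in> {0<..<p j}" "q u = m"
      using ex[of 0 "p j"] pj by auto
    obtain v where v: "v \<in> {p j<..<1}" "q v = m"
      using ex[of "p j" 1] pj by auto
    show ?thesis
      using mono_onD[OF q(1), of u "p j"] mono_onD[OF q(1), of "p j" v] u v pj by auto
  qed
  then have "z = (\<Sum>j=1..J. \<omega> j * U m)"
    unfolding z by (intro sum.cong) auto
  then have "z = U m"
    using total by (rule trans)
  then show "z \<le> U m"
    by simp
qed

section \<open>Structure of the worst case\<close>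

theorem theorem3:
  fixes \<mu> \<sigma> \<eta> c m :: real
    and K J :: nat
    and a b g p \<omega> \<pi> :: "nat \<Rightarrow> real"
    and U :: "real \<Rightarrow> real" and U_bar \<Psi>_max :: real and G :: "real \<Rightarrow> real"
  assumes \<sigma>: "\<sigma> \<ge> 0" and \<eta>: "\<eta> > 0" and c: "c \<ge> 0" and m: "m = \<mu> - \<eta> * c"
    and K: "K \<ge> 1"
    and ab: "\<And>k. k \<in> {1..K} \<Longrightarrow> a k < b k"
    and ba: "\<And>k. k \<in> {1..<K} \<Longrightarrow> b k \<le> a (k + 1)"
    and g: "\<And>k. k \<in> {1..K} \<Longrightarrow> g k > 0"
    and U: "U = credit_utility K a b g"
    and U_bar: "U_bar = U (b K)"
    and J: "J \<ge> 1"
    and p_first: "0 < p 1"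
    and p_incr: "\<And>j. j \<in> {1..<J} \<Longrightarrow> p j < p (j + 1)"
    and p_last: "p J < 1"
    and \<omega>_pos: "\<And>j. j \<in> {1..J} \<Longrightarrow> \<omega> j > 0"
    and \<omega>_sum: "(\<Sum>j=1..J. \<omega> j) = 1"
    and \<pi>: "\<pi> = breakpoint_mass J p"
    and \<Psi>_max: "\<Psi>_max = worst_liability U J p \<omega> \<mu> \<sigma> \<eta> c"
    and G: "G = reduced_credit U J p \<omega> \<sigma>"
  shows
    "(\<sigma>\<^sup>2 = 0 \<longrightarrow>
       (\<lambda>M. distr M borel (\<lambda>x. x - \<eta> * c)) ` ambiguity_set \<mu> (\<sigma>\<^sup>2) = {return borel m}
       \<and> G m = U m)
   \<and> (\<sigma>\<^sup>2 > 0 \<longrightarrow>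
       \<Psi>_max = G m
       \<and> (\<exists>cs. solves_program U J \<omega> \<pi> \<sigma> m cs)
       \<and> (\<forall>cs. solves_program U J \<omega> \<pi> \<sigma> m cs \<longrightarrow>
            \<comment> \<open>value of the program and attainment by the staircase load\<close>
            (program_value U J \<omega> cs = G m
             \<and> (\<exists>M\<in>ambiguity_set \<mu> (\<sigma>\<^sup>2).
                  (\<forall>u\<in>{0..<p 1}. upper_quantile (distr M borel (\<lambda>x. x - \<eta> * c)) u = cs 0)
                  \<and> (\<forall>j\<in>{1..J}. \<forall>u\<in>{p j..<next_percentile J p j}.
                       upper_quantile (distr M borel (\<lambda>x. x - \<eta> * c)) u = cs j)
                  \<and> liability U J p \<omega> \<eta> c M = \<Psi>_max))
            \<comment> \<open>(a)\<close>
            \<and> ((\<exists>lam1 lam2 \<xi> \<nu>. program_multipliers U J \<omega> \<pi> cs lam1 lam2 \<xi> \<nu>)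
               \<and> (\<forall>lam1 lam2 \<xi> \<nu>. program_multipliers U J \<omega> \<pi> cs lam1 lam2 \<xi> \<nu> \<and> lam2 > 0 \<longrightarrow>
                    (\<forall>j\<in>{1..J}. cs j \<noteq> cs (j - 1) \<and> (j < J \<longrightarrow> cs j \<noteq> cs (j + 1)) \<longrightarrow>
                       cs j = base_level lam1 lam2 + \<omega> j * \<xi> j / (2 * lam2 * \<pi> j))
                    \<and> (cs 0 < cs 1 \<longrightarrow> cs 0 = base_level lam1 lam2)
                    \<and> isotonic_regression (J + 1) \<pi> (level_candidate \<omega> \<pi> lam1 lam2 \<xi>) cs
                    \<and> pava (map (\<lambda>j. (level_candidate \<omega> \<pi> lam1 lam2 \<xi> j, \<pi> j)) [0..<J + 1])
                        = map cs [0..<J + 1]))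
            \<comment> \<open>(b)\<close>
            \<and> ((\<forall>i j. i \<le> j \<and> j \<le> J \<longrightarrow> cs i \<le> cs j)
               \<and> (\<forall>i j. 1 \<le> i \<and> i \<le> j \<and> j \<le> J \<longrightarrow>
                    credit_tier K a b (cs i) \<le> credit_tier K a b (cs j))
               \<and> (cs 0 < a 1 \<longrightarrow>
                    credit_tier K a b (cs 0) = Benign
                    \<and> (\<forall>i\<le>J. \<forall>j\<le>J. credit_tier K a b (cs i) < credit_tier K a b (cs j) \<longrightarrow>
                         cs i \<le> cs j)))
            \<comment> \<open>(c)\<close>
            \<and> ((\<forall>j\<in>{1..J}. credit_tier K a b (cs j) = Catastrophic \<longrightarrow> U (cs j) = U_bar)
               \<and> (\<forall>j\<in>{1..J}. credit_tier K a b (cs j) = Benign \<longrightarrow> U (cs j) = 0)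
               \<and> 0 \<le> G m \<and> G m \<le> U_bar))
       \<comment> \<open>(c), running time: \<open>C\<close> is uniform over all inputs of all lengths\<close>
       \<and> (\<exists>C. \<forall>xs. xs \<noteq> [] \<and> (\<forall>(r, w)\<in>set xs. w > 0) \<longrightarrow>
            length (pava xs) = length xs
            \<and> isotonic_regression (length xs) (\<lambda>j. snd (xs ! j)) (\<lambda>j. fst (xs ! j)) (\<lambda>j. pava xs ! j)
            \<and> T_pava xs \<le> C * length xs))"
proof -
  interpret credit_steps K a b g
    by standard (use K ab ba g in auto)
  interpret percentile_grid J p
    by standard (use J p_first p_incr p_last in auto)
  have mono: "U s \<le> U t" if "s \<le> t" for s t
    unfolding U using that by (rule U_mono)
  have pos: "0 < \<pi> j" if "j \<le> J" for j
    unfolding \<pi> using that by (rule \<pi>_pos)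
  have cs_mono: "cs i \<le> cs j" if "solves_program U J \<omega> \<pi> \<sigma> m cs" "i \<le> j" "j \<le> J" for cs i j
    using program_feasible_mono that unfolding solves_program_def by blast

  have degenerate: "(\<lambda>M. distr M borel (\<lambda>x. x - \<eta> * c)) ` ambiguity_set \<mu> (\<sigma>\<^sup>2) = {return borel m}"
    "G m = U m" if "\<sigma>\<^sup>2 = 0"
    using that reduced_credit_zero_variance[OF \<omega>_sum, of U m]
    by (simp_all add: ambiguity_set_zero_variance distr_return m G)

  have solution: "\<exists>cs. solves_program U J \<omega> \<pi> \<sigma> m cs"
  proof -
    obtain y where "program_feasible J \<pi> \<sigma> m y"
      using program_feasible_exists[OF sum_mass] unfolding \<pi> by blast
    then show ?thesis
      using program_has_solution[OF U_continuous] unfolding \<pi> U by blast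
  qed
  have G_eq: "G m = program_value U J \<omega> cs" if "solves_program U J \<omega> \<pi> \<sigma> m cs" for cs
    unfolding G
  proof (rule reduced_credit_eq_program_value)
    show "solves_program U J \<omega> (breakpoint_mass J p) \<sigma> m cs"
      using that unfolding \<pi> .
  qed (use mono \<omega>_pos in auto)
  have \<Psi>_eq: "\<Psi>_max = program_value U J \<omega> cs" if "solves_program U J \<omega> \<pi> \<sigma> m cs" for cs
    unfolding \<Psi>_max
  proof (rule worst_liability_eq_program_value)
    show "solves_program U J \<omega> (breakpoint_mass J p) \<sigma> (\<mu> - \<eta> * c) cs"
      using that unfolding \<pi> m .
  qed (use mono \<omega>_pos in auto)

  have attained: "\<exists>M\<in>ambiguity_set \<mu> (\<sigma>\<^sup>2).
      (\<forall>u\<in>{0..<p 1}. upper_quantile (distr M borel (\<lambda>x. x - \<eta> * c)) u = cs 0)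
      \<and> (\<forall>j\<in>{1..J}. \<forall>u\<in>{p j..<next_percentile J p j}.
           upper_quantile (distr M borel (\<lambda>x. x - \<eta> * c)) u = cs j)
      \<and> liability U J p \<omega> \<eta> c M = \<Psi>_max" if cs: "solves_program U J \<omega> \<pi> \<sigma> m cs" for cs
  proof -
    have feasible: "program_feasible J (breakpoint_mass J p) \<sigma> (\<mu> - \<eta> * c) cs"
      using cs by (simp add: solves_program_def \<pi> m)
    have quantile: "upper_quantile (distr (staircase_law cs (\<eta> * c)) borel (\<lambda>x. x - \<eta> * c)) u = cs j"
      if "j \<le> J" "u \<in> {cut j..<cut (Suc j)}" for j u
      using upper_quantile_staircase_law[OF feasible that, of 0]
      unfolding staircase_law_shift[OF feasible] by simp
    have "p 1 = cut (Suc 0)" "next_percentile J p j = cut (Suc j)" for j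
      using J by (simp_all add: cut_def next_percentile_def)
    then show ?thesis
      using staircase_law_in_ambiguity_set[OF feasible] quantile cut_p cut_0
        liability_staircase_law[OF feasible, of U \<omega> \<eta> c] \<Psi>_eq[OF cs]
      by (intro bexI[of _ "staircase_law cs (\<eta> * c)"] conjI ballI) auto
  qed

  have multipliers: "\<exists>lam1 lam2 \<xi> \<nu>. program_multipliers U J \<omega> \<pi> cs lam1 lam2 \<xi> \<nu>"
    if cs: "solves_program U J \<omega> \<pi> \<sigma> m cs" and "0 < \<sigma>\<^sup>2" for cs
  proof (rule program_multipliers_exist[OF cs _ _ pos \<omega>_pos])
    show "0 < \<sigma>"
      using \<sigma> \<open>0 < \<sigma>\<^sup>2\<close> by (simp add: less_le)
    show "(\<Sum>j=0..J. \<pi> j) = 1"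
      using sum_mass unfolding \<pi> .
    show "\<exists>l r. kink U (cs j) l r" for j
      unfolding U by (rule kink_credit_utility)
  qed
  have regression: "\<forall>lam1 lam2 \<xi> \<nu>. program_multipliers U J \<omega> \<pi> cs lam1 lam2 \<xi> \<nu> \<and> lam2 > 0 \<longrightarrow>
      (\<forall>j\<in>{1..J}. cs j \<noteq> cs (j - 1) \<and> (j < J \<longrightarrow> cs j \<noteq> cs (j + 1)) \<longrightarrow>
         cs j = base_level lam1 lam2 + \<omega> j * \<xi> j / (2 * lam2 * \<pi> j))
      \<and> (cs 0 < cs 1 \<longrightarrow> cs 0 = base_level lam1 lam2)
      \<and> isotonic_regression (J + 1) \<pi> (level_candidate \<omega> \<pi> lam1 lam2 \<xi>) cs
      \<and> pava (map (\<lambda>j. (level_candidate \<omega> \<pi> lam1 lam2 \<xi> j, \<pi> j)) [0..<J + 1])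
          = map cs [0..<J + 1]"
    if cs: "solves_program U J \<omega> \<pi> \<sigma> m cs" for cs
  proof (intro allI impI)
    fix lam1 lam2 \<xi> \<nu>
    assume mult: "program_multipliers U J \<omega> \<pi> cs lam1 lam2 \<xi> \<nu> \<and> lam2 > 0"
    have "mono_on {..<J + 1} cs"
      by (rule mono_onI) (use cs_mono[OF cs] in auto)
    then have iso: "isotonic_regression (J + 1) \<pi> (level_candidate \<omega> \<pi> lam1 lam2 \<xi>) cs"
      using mult pos by (intro multipliers_isotonic_regression) auto
    moreover have "pava (map (\<lambda>j. (level_candidate \<omega> \<pi> lam1 lam2 \<xi> j, \<pi> j)) [0..<J + 1])
        = map cs [0..<J + 1]"
      by (rule isotonic_regression_eq_pava[OF iso]) (use pos in auto)
    moreover have "cs j = base_level lam1 lam2 + \<omega> j * \<xi> j / (2 * lam2 * \<pi> j)"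
      if "j \<in> {1..J}" "cs j \<noteq> cs (j - 1)" "j < J \<longrightarrow> cs j \<noteq> cs (j + 1)" for j
      using isolated_level[of U J \<omega> \<pi> cs lam1 lam2 \<xi> \<nu> j] mult pos[of j] that by auto
    moreover have "cs 0 = base_level lam1 lam2" if "cs 0 < cs 1"
      using isolated_bulk_level[of U J \<omega> \<pi> cs lam1 lam2 \<xi> \<nu>] mult pos[of 0] J that by auto
    ultimately show "(\<forall>j\<in>{1..J}. cs j \<noteq> cs (j - 1) \<and> (j < J \<longrightarrow> cs j \<noteq> cs (j + 1)) \<longrightarrow>
         cs j = base_level lam1 lam2 + \<omega> j * \<xi> j / (2 * lam2 * \<pi> j))
      \<and> (cs 0 < cs 1 \<longrightarrow> cs 0 = base_level lam1 lam2)
      \<and> isotonic_regression (J + 1) \<pi> (level_candidate \<omega> \<pi> lam1 lam2 \<xi>) cs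
      \<and> pava (map (\<lambda>j. (level_candidate \<omega> \<pi> lam1 lam2 \<xi> j, \<pi> j)) [0..<J + 1])
          = map cs [0..<J + 1]"
      by blast
  qed

  have tiers: "(\<forall>i j. i \<le> j \<and> j \<le> J \<longrightarrow> cs i \<le> cs j)
      \<and> (\<forall>i j. 1 \<le> i \<and> i \<le> j \<and> j \<le> J \<longrightarrow> credit_tier K a b (cs i) \<le> credit_tier K a b (cs j))
      \<and> (cs 0 < a 1 \<longrightarrow> credit_tier K a b (cs 0) = Benign
          \<and> (\<forall>i\<le>J. \<forall>j\<le>J. credit_tier K a b (cs i) < credit_tier K a b (cs j) \<longrightarrow> cs i \<le> cs j))"
    if cs: "solves_program U J \<omega> \<pi> \<sigma> m cs" for cs
  proof (intro conjI allI impI)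
    show "cs i \<le> cs j" if "i \<le> j \<and> j \<le> J" for i j
      using cs_mono[OF cs] that by blast
    show "credit_tier K a b (cs i) \<le> credit_tier K a b (cs j)" if "1 \<le> i \<and> i \<le> j \<and> j \<le> J" for i j
      using cs_mono[OF cs] that by (intro credit_tier_mono) blast
    show "credit_tier K a b (cs 0) = Benign" if "cs 0 < a 1"
      using that by (simp add: credit_tier_def)
    show "cs i \<le> cs j" if "credit_tier K a b (cs i) < credit_tier K a b (cs j)" for i j
      using that credit_tier_mono[of "cs j" "cs i"] by (meson linear not_le)
  qed

  have credits: "(\<forall>j\<in>{1..J}. credit_tier K a b (cs j) = Catastrophic \<longrightarrow> U (cs j) = U_bar)
      \<and> (\<forall>j\<in>{1..J}. credit_tier K a b (cs j) = Benign \<longrightarrow> U (cs j) = 0)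
      \<and> 0 \<le> G m \<and> G m \<le> U_bar" if cs: "solves_program U J \<omega> \<pi> \<sigma> m cs" for cs
  proof (intro conjI ballI impI)
    fix j assume "credit_tier K a b (cs j) = Catastrophic"
    then have "b K \<le> cs j"
      by (auto simp: credit_tier_def split: if_splits)
    then show "U (cs j) = U_bar"
      unfolding U_bar U by (rule U_above)
  next
    fix j assume "credit_tier K a b (cs j) = Benign"
    then have "cs j \<le> a 1"
      by (auto simp: credit_tier_def split: if_splits)
    then show "U (cs j) = 0"
      unfolding U by (rule U_below)
  next
    show "0 \<le> G m"
      unfolding G_eq[OF cs] program_value_def U using \<omega>_pos U_nonneg
      by (auto intro!: sum_nonneg mult_nonneg_nonneg simp: less_imp_le)
    have "(\<Sum>j=1..J. \<omega> j * U (cs j)) \<le> (\<Sum>j=1..J. \<omega> j * U_bar)"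
      unfolding U_bar U using \<omega>_pos U_le_total
      by (intro sum_mono mult_left_mono) (auto simp: less_imp_le)
    then show "G m \<le> U_bar"
      unfolding G_eq[OF cs] program_value_def using \<omega>_sum by (simp add: sum_distrib_right[symmetric])
  qed

  have pava_linear_time: "\<exists>C. \<forall>xs. xs \<noteq> [] \<and> (\<forall>(r, w)\<in>set xs. w > 0) \<longrightarrow>
      length (pava xs) = length xs
      \<and> isotonic_regression (length xs) (\<lambda>j. snd (xs ! j)) (\<lambda>j. fst (xs ! j)) (\<lambda>j. pava xs ! j)
      \<and> T_pava xs \<le> C * length xs"
  \<comment> \<open>the scan and the expansion cost at most \<open>3 n + 1\<close> each, and \<open>6 n + 3 \<le> 9 n\<close> for \<open>n \<ge> 1\<close>\<close>
  proof (intro exI[of _ 9] allI impI conjI)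
    fix xs :: "(real \<times> real) list"
    assume xs: "xs \<noteq> [] \<and> (\<forall>(r, w)\<in>set xs. w > 0)"
    then have pos: "\<forall>e\<in>set xs. 0 < snd e"
      by auto
    show "length (pava xs) = length xs"
      "isotonic_regression (length xs) (\<lambda>j. snd (xs ! j)) (\<lambda>j. fst (xs ! j)) (\<lambda>j. pava xs ! j)"
      using pava_isotonic_regression[OF pos] by blast+
    show "T_pava xs \<le> 9 * length xs"
      using T_pava_linear[OF _ pos] xs by blast
  qed

  obtain cs where "solves_program U J \<omega> \<pi> \<sigma> m cs"
    using solution by blast
  then have "\<Psi>_max = G m"
    using G_eq \<Psi>_eq by simp
  show ?thesis
    (is "(_ \<longrightarrow> ?degenerate) \<and> (_ \<longrightarrow> _ \<and> _ \<and> (\<forall>cs. _ cs \<longrightarrow> ?structure cs) \<and> _)")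
  proof (rule conjI; rule impI)
    show ?degenerate if "\<sigma>\<^sup>2 = 0"
      using degenerate[OF that] by (rule conjI)
    assume "0 < \<sigma>\<^sup>2"
    have all_parts: "?structure cs" if cs: "solves_program U J \<omega> \<pi> \<sigma> m cs" for cs
      using conjI[OF conjI[OF G_eq[OF cs, symmetric] attained[OF cs]]
          conjI[OF conjI[OF multipliers[OF cs \<open>0 < \<sigma>\<^sup>2\<close>] regression[OF cs]]
            conjI[OF tiers[OF cs] credits[OF cs]]]] .
    show "\<Psi>_max = G m \<and> (\<exists>cs. solves_program U J \<omega> \<pi> \<sigma> m cs)
        \<and> (\<forall>cs. solves_program U J \<omega> \<pi> \<sigma> m cs \<longrightarrow> ?structure cs)
        \<and> (\<exists>C. \<forall>xs. xs \<noteq> [] \<and> (\<forall>(r, w)\<in>set xs. w > 0) \<longrightarrow>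
            length (pava xs) = length xs
            \<and> isotonic_regression (length xs) (\<lambda>j. snd (xs ! j)) (\<lambda>j. fst (xs ! j)) (\<lambda>j. pava xs ! j)
            \<and> T_pava xs \<le> C * length xs)"
      by (rule conjI[OF \<open>\<Psi>_max = G m\<close> conjI[OF solution conjI[OF _ pava_linear_time]]])
        (use all_parts in blast)
  qed
qed

end
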